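(* Let $\Omega\subset\mathbb C^n$ be a bounded open set and $q\in\mathbb R$, $q>1$. Suppose that for every $\zeta\in\partial\Omega$ there exists $f_\zeta\in\bigcap_{p<q}\mathcal{O}L^p(\Omega)$ with $\lim_{z\to\zeta,\,z\in\Omega}f_\zeta(z)=\infty$. Then the set of functions $g\in\bigcap_{p<q}\mathcal{O}L^p(\Omega)$ which are totally unbounded in $\Omega$ is dense and $G_\delta$ in $\bigcap_{p<q}\mathcal{O}L^p(\Omega)$. Also the set of functions $h\in\bigcap_{p<q}\mathcal{O}L^p(\Omega)$ which are singular at every boundary point of $\Omega$ is dense and $G_\delta$ in $\bigcap_{p<q}\mathcal{O}L^p(\Omega)$. The same conclusions hold for $q=\infty$.
   Context: For a bounded open $\Omega\subset\mathbb C^n$ and $p\ge1$, $\mathcal{O}L^p(\Omega)$ is the Banach space of holomorphic $f:\Omega\to\mathbb C$ with $\|f\|_p=(\int_\Omega|f|^p\,dv)^{1/p}<\infty$ ($dv$ = Lebesgue measure); $\mathcal{O}L^\infty(\Omega)$ is the space of bounded holomorphic functions with the sup norm. For $1<q\le\infty$, $\bigcap_{p<q}\mathcal{O}L^p(\Omega)$ carries the complete metric $d(f,g)=\sum_j 2^{-j}\frac{\|f-g\|_{p_j}}{1+\|f-g\|_{p_j}}$ where $1<p_1<p_2<\dots<q$, $p_j\to q$; thus $f_k\to f$ iff $\|f_k-f\|_p\to0$ for every $p<q$; it is a topological vector space. A holomorphic $f$ is totally unbounded in $\Omega$ if for every $w\in\partial\Omega$, $\delta>0$ and every connected component $E$ of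 $B(w,\delta)\cap\Omega$, $\sup_E|f|=\infty$. A holomorphic $f$ on $\Omega$ is singular at every boundary point of $\Omega$ if whenever $U,V\subset\mathbb C^n$ are open, $U$ connected, $\emptyset\ne V\subseteq U\cap\Omega\ne U$, there is no holomorphic $F$ on $U$ with $F=f$ on $V$. *)

theory Defs
  imports "HOL-Analysis.Analysis"
begin

definition holo_on :: "(complex ^ 'n) set \<Rightarrow> (complex ^ 'n \<Rightarrow> complex) \<Rightarrow> bool" where
  "holo_on S f \<longleftrightarrow>
     (\<forall>z\<in>S. \<exists>L. (f has_derivative L) (at z) \<and> (\<forall>c v. L (c *s v) = c * L v))"

definition Lp_norm :: "real \<Rightarrow> (complex ^ 'n) set \<Rightarrow> (complex ^ 'n \<Rightarrow> complex) \<Rightarrow> real" where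
  "Lp_norm p \<Omega> f = enn2real (\<integral>\<^sup>+ x\<in>\<Omega>. ennreal (cmod (f x) powr p) \<partial>lborel) powr (1 / p)"

text \<open>The space of holomorphic functions on Omega lying in OL^p for all 1 <= p < q.
  Functions are normalised to vanish outside Omega, so that they are determined
  by their values on Omega.\<close>
definition OLq :: "ereal \<Rightarrow> (complex ^ 'n) set \<Rightarrow> (complex ^ 'n \<Rightarrow> complex) set" where
  "OLq q \<Omega> = {f. holo_on \<Omega> f \<and> (\<forall>x. x \<notin> \<Omega> \<longrightarrow> f x = 0) \<and>
     (\<forall>p. 1 \<le> p \<and> ereal p < q \<longrightarrow> (\<integral>\<^sup>+ x\<in>\<Omega>. ennreal (cmod (f x) powr p) \<partial>lborel) < \<infinity>)}"

text \<open>The metric d(f,g) = sum_j 2^{-j} N_j/(1+N_j), N_j = norm of f-g in L^{p_j};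
  ps j stands for p_{j+1}.\<close>
definition OLdist :: "(nat \<Rightarrow> real) \<Rightarrow> (complex ^ 'n) set \<Rightarrow>
    (complex ^ 'n \<Rightarrow> complex) \<Rightarrow> (complex ^ 'n \<Rightarrow> complex) \<Rightarrow> real" where
  "OLdist ps \<Omega> f g = (\<Sum>j. (1/2) ^ (Suc j) *
      (Lp_norm (ps j) \<Omega> (\<lambda>z. f z - g z) / (1 + Lp_norm (ps j) \<Omega> (\<lambda>z. f z - g z))))"

definition admissible_seq :: "ereal \<Rightarrow> (nat \<Rightarrow> real) \<Rightarrow> bool" where
  "admissible_seq q ps \<longleftrightarrow> 1 < ps 0 \<and> strict_mono ps \<and> (\<forall>j. ereal (ps j) < q)
     \<and> ((\<lambda>j. ereal (ps j)) \<longlonglongrightarrow> q)"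

definition OL_open :: "ereal \<Rightarrow> (nat \<Rightarrow> real) \<Rightarrow> (complex ^ 'n) set \<Rightarrow>
    (complex ^ 'n \<Rightarrow> complex) set \<Rightarrow> bool" where
  "OL_open q ps \<Omega> U \<longleftrightarrow> U \<subseteq> OLq q \<Omega> \<and>
     (\<forall>f\<in>U. \<exists>e>0. \<forall>g\<in>OLq q \<Omega>. OLdist ps \<Omega> f g < e \<longrightarrow> g \<in> U)"

definition OL_dense :: "ereal \<Rightarrow> (nat \<Rightarrow> real) \<Rightarrow> (complex ^ 'n) set \<Rightarrow>
    (complex ^ 'n \<Rightarrow> complex) set \<Rightarrow> bool" where
  "OL_dense q ps \<Omega> A \<longleftrightarrow> A \<subseteq> OLq q \<Omega> \<and>
     (\<forall>f\<in>OLq q \<Omega>. \<forall>e>0. \<exists>g\<in>A. OLdist ps \<Omega> f g < e)"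

definition OL_Gdelta :: "ereal \<Rightarrow> (nat \<Rightarrow> real) \<Rightarrow> (complex ^ 'n) set \<Rightarrow>
    (complex ^ 'n \<Rightarrow> complex) set \<Rightarrow> bool" where
  "OL_Gdelta q ps \<Omega> A \<longleftrightarrow>
     (\<exists>U :: nat \<Rightarrow> (complex ^ 'n \<Rightarrow> complex) set. (\<forall>k. OL_open q ps \<Omega> (U k)) \<and> A = (\<Inter>k. U k))"

definition totally_unbounded :: "(complex ^ 'n) set \<Rightarrow> (complex ^ 'n \<Rightarrow> complex) \<Rightarrow> bool" where
  "totally_unbounded \<Omega> f \<longleftrightarrow>
     (\<forall>w\<in>frontier \<Omega>. \<forall>\<delta>>0. \<forall>E\<in>components (ball w \<delta> \<inter> \<Omega>).
        (SUP z\<in>E. ereal (cmod (f z))) = \<infinity>)"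

definition singular_at_boundary :: "(complex ^ 'n) set \<Rightarrow> (complex ^ 'n \<Rightarrow> complex) \<Rightarrow> bool" where
  "singular_at_boundary \<Omega> f \<longleftrightarrow>
     (\<forall>U V. open U \<and> open V \<and> connected U \<and> V \<noteq> {} \<and> V \<subseteq> U \<inter> \<Omega> \<and> U \<inter> \<Omega> \<noteq> U \<longrightarrow>
        \<not> (\<exists>F. holo_on U F \<and> (\<forall>z\<in>V. F z = f z)))"

end

theory Submission
  imports Defs "HOL-Complex_Analysis.Great_Picard"
begin

text \<open>
  Baire category in the complete metric space \<open>X = OLq q \<Omega>\<close>. By the mean value property, the value
  at a point is bounded by the \<open>L\<^sup>p\<close> norm, so convergence in \<open>X\<close> is locally uniform and \<open>X\<close> is
  complete. A component \<open>E\<close> of \<open>U \<inter> \<Omega>\<close>, for a connected open \<open>U\<close> not inside \<open>\<Omega>\<close>, accumulates at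
  a boundary point \<open>\<zeta> \<in> U\<close>, and it contains a component of \<open>B \<inter> \<Omega>\<close> for a ball \<open>B\<close> near \<open>\<zeta>\<close> taken
  from a countable family. Hence total unboundedness is a countable intersection of the
  conditions \<open>sup\<^sub>E |g| > m\<close>; each is open, and dense because adding a small multiple of the
  function blowing up at \<open>\<zeta>\<close> to a function bounded on \<open>E\<close> makes it unbounded on \<open>E\<close>.
  Likewise, \<open>h\<close> is singular at the boundary iff, for no pair \<open>(B, E)\<close> of the family and no \<open>m\<close>,
  \<open>h\<close> extends from \<open>E\<close> to a function on \<open>B\<close> that is bounded by \<open>m\<close> and \<open>m\<close>-Lipschitz; by
  Arzela-Ascoli, being so extendable is a closed condition. Totally unbounded functions satisfy the
  singularity condition, which gives density of the latter.
\<close>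

section \<open>Holomorphic functions of several variables\<close>

lemma norm_vector_smult: "norm (c *s (v :: complex ^ 'n)) = cmod c * norm v"
proof -
  have "norm (c *s v) = L2_set (\<lambda>i. cmod c * cmod (v $ i)) UNIV"
    by (simp add: norm_vec_def norm_mult)
  also have "\<dots> = cmod c * norm v"
    by (simp add: norm_vec_def L2_set_right_distrib)
  finally show ?thesis .
qed

lemma bounded_linear_smult_left: "bounded_linear (\<lambda>t::complex. t *s (v :: complex ^ 'n))"
proof (rule bounded_linear_intro)
  show "(x + y) *s v = x *s v + y *s v" for x y
    by (rule vector_sadd_rdistrib)
  show "(r *\<^sub>R x) *s v = r *\<^sub>R (x *s v)" for r x
    by (simp add: vec_eq_iff)
  show "norm (x *s v) \<le> norm x * norm v" for x
    by (simp add: norm_vector_smult)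
qed

lemma linear_smult_right: "linear (\<lambda>v :: complex ^ 'n. c *s v)"
  by (rule linearI) (simp_all add: vec_eq_iff algebra_simps)

section \<open>Algebra of holomorphic functions and their restrictions to complex lines\<close>

lemma holo_on_subset: "holo_on S f \<Longrightarrow> T \<subseteq> S \<Longrightarrow> holo_on T f"
  unfolding holo_on_def by blast

lemma holo_on_imp_continuous_on: "holo_on S f \<Longrightarrow> continuous_on S f"
  unfolding holo_on_def
  by (meson continuous_at_imp_continuous_on has_derivative_continuous)

lemma holo_on_add:
  assumes "holo_on S f" "holo_on S g"
  shows "holo_on S (\<lambda>z. f z + g z)"
  unfolding holo_on_def
proof
  fix z assume "z \<in> S"
  then obtain L M where "(f has_derivative L) (at z)" "\<forall>c v. L (c *s v) = c * L v"
     "(g has_derivative M) (at z)" "\<forall>c v. M (c *s v) = c * M v"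
    using assms unfolding holo_on_def by metis
  then show "\<exists>L. ((\<lambda>z. f z + g z) has_derivative L) (at z) \<and> (\<forall>c v. L (c *s v) = c * L v)"
    by (intro exI[of _ "\<lambda>v. L v + M v"]) (auto intro!: derivative_intros simp: algebra_simps)
qed

lemma holo_on_cmult:
  assumes "holo_on S f"
  shows "holo_on S (\<lambda>z. a * f z)"
  unfolding holo_on_def
proof
  fix z assume "z \<in> S"
  then obtain L where "(f has_derivative L) (at z)" "\<forall>c v. L (c *s v) = c * L v"
    using assms unfolding holo_on_def by metis
  then show "\<exists>L. ((\<lambda>z. a * f z) has_derivative L) (at z) \<and> (\<forall>c v. L (c *s v) = c * L v)"
    by (intro exI[of _ "\<lambda>v. a * L v"]) (auto intro!: derivative_eq_intros simp: algebra_simps)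
qed

lemma holo_on_diff: "holo_on S f \<Longrightarrow> holo_on S g \<Longrightarrow> holo_on S (\<lambda>z. f z - g z)"
  using holo_on_add[of S f "\<lambda>z. (-1) * g z"] holo_on_cmult[of S g "-1"] by simp

text \<open>Reduction to one variable: complex homogeneity of \<open>L\<close> makes the
  differential \<open>s \<mapsto> L (s *s v)\<close> of the slice a multiplication by
  \<open>L v\<close>, so the real chain rule yields a complex derivative.\<close>

lemma slice_has_field_derivative:
  fixes f :: "complex ^ 'n \<Rightarrow> complex"
  assumes "(f has_derivative L) (at (z + t *s v))" "\<forall>c v. L (c *s v) = c * L v"
  shows "((\<lambda>t. f (z + t *s v)) has_field_derivative L v) (at t)"
proof -
  have "((\<lambda>t. z + t *s v) has_derivative (\<lambda>s. s *s v)) (at t)"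
    using bounded_linear_imp_has_derivative[OF bounded_linear_smult_left[of v]]
    by (auto intro!: derivative_eq_intros)
  from has_derivative_compose[OF this assms(1)]
  have "((\<lambda>t. f (z + t *s v)) has_derivative (\<lambda>s. L (s *s v))) (at t)" .
  moreover have "(\<lambda>s. L (s *s v)) = (*) (L v)"
    using assms(2) by (auto simp: mult.commute)
  ultimately show ?thesis
    by (simp add: has_field_derivative_def)
qed

lemma holo_on_slice:
  assumes "holo_on S f" "\<And>t. t \<in> T \<Longrightarrow> z + t *s v \<in> S"
  shows "(\<lambda>t. f (z + t *s v)) holomorphic_on T"
proof -
  have "\<exists>D. ((\<lambda>t. f (z + t *s v)) has_field_derivative D) (at t)" if "t \<in> T" for t
    using assms(1) assms(2)[OF that] slice_has_field_derivative unfolding holo_on_def by blast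
  then show ?thesis
    by (meson field_differentiable_at_within field_differentiable_def holomorphic_onI)
qed

text \<open>Cauchy's inequality for the slice \<open>t \<mapsto> f (z + t *s v)\<close>, whose
  derivative at \<open>0\<close> is \<open>L v\<close>.\<close>

lemma holo_on_derivative_bound:
  fixes f :: "complex ^ 'n \<Rightarrow> complex"
  assumes holo: "holo_on (ball z r) f" and "0 < r"
    and M: "\<And>w. w \<in> ball z r \<Longrightarrow> cmod (f w) \<le> M"
    and L: "(f has_derivative L) (at z)" "\<forall>c v. L (c *s v) = c * L v"
  shows "cmod (L v) \<le> 2 * M / r * norm v"
proof (cases "v = 0")
  case True
  then show ?thesis using L(2)[rule_format, of 0 0] by simp
next
  case False
  \<comment> \<open>The disc of radius \<open>\<rho>\<close> goes into the closed ball of radius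
    \<open>r / 2\<close>, so the slice is holomorphic on the closed disc; the halving is the source
    of the factor \<open>2\<close>.\<close>
  define \<rho> where "\<rho> = r / (2 * norm v)"
  have "\<rho> > 0" using False \<open>0 < r\<close> by (simp add: \<rho>_def)
  have in_ball: "z + t *s v \<in> ball z r" if "t \<in> cball 0 \<rho>" for t
  proof -
    have "cmod t * norm v \<le> \<rho> * norm v"
      using that by (intro mult_right_mono) auto
    also have "\<dots> < r" using False \<open>0 < r\<close> by (simp add: \<rho>_def)
    finally show ?thesis by (simp add: dist_norm norm_vector_smult)
  qed
  define g where "g = (\<lambda>t. f (z + t *s v))"
  have hol: "g holomorphic_on cball 0 \<rho>"
    unfolding g_def using holo in_ball by (rule holo_on_slice)
  have "cmod ((deriv ^^ 1) g 0) \<le> fact 1 * M / \<rho> ^ 1"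
  proof (rule Cauchy_inequality)
    show "g holomorphic_on ball 0 \<rho>"
      using hol holomorphic_on_subset ball_subset_cball by blast
    show "continuous_on (cball 0 \<rho>) g"
      using hol holomorphic_on_imp_continuous_on by blast
    show "cmod (g t) \<le> M" if "cmod (0 - t) = \<rho>" for t
      unfolding g_def using that by (intro M in_ball) auto
  qed fact
  moreover have "deriv g 0 = L v"
    unfolding g_def using L by (intro DERIV_imp_deriv slice_has_field_derivative) auto
  ultimately show ?thesis
    by (simp add: \<rho>_def field_simps)
qed

section \<open>Locally uniform limits of holomorphic functions\<close>

lemma ball_half_subset:
  fixes w z :: "'a :: metric_space"
  assumes "w \<in> ball z (r / 2)"
  shows "ball w (r / 2) \<subseteq> ball z r"
proof
  fix x assume "x \<in> ball w (r / 2)"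
  with assms have "dist z w < r / 2" "dist w x < r / 2" by auto
  then have "dist z x < r" using dist_triangle[of z x w] by linarith
  then show "x \<in> ball z r" by simp
qed

text \<open>Weierstrass' theorem: Cauchy estimates for \<open>f m - f n\<close> make the
  differentials uniformly Cauchy on a smaller ball, so the limit can be differentiated termwise;
  complex homogeneity passes to the limit of the differentials.\<close>

lemma holo_on_uniform_limit:
  fixes f :: "nat \<Rightarrow> complex ^ 'n \<Rightarrow> complex"
  assumes holo: "\<And>n. holo_on S (f n)"
    and lim: "\<And>z. z \<in> S \<Longrightarrow> \<exists>r>0. ball z r \<subseteq> S \<and> uniform_limit (ball z r) f g sequentially"
  shows "holo_on S g"
  unfolding holo_on_def
proof
  fix z assume "z \<in> S"
  then obtain r where r: "r > 0" "ball z r \<subseteq> S" "uniform_limit (ball z r) f g sequentially"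
    using lim by blast
  define s where "s = r / 2"
  have s: "s > 0" "\<And>w. w \<in> ball z s \<Longrightarrow> ball w s \<subseteq> ball z r"
    using r(1) ball_half_subset by (auto simp: s_def)
  have zw: "ball z s \<subseteq> S" using r(1,2) by (auto simp: s_def)
  have "\<forall>n w. \<exists>L. w \<in> ball z s \<longrightarrow> (f n has_derivative L) (at w) \<and> (\<forall>c v. L (c *s v) = c * L v)"
    using holo zw unfolding holo_on_def by (metis subsetD)
  then obtain f' where f':
    "\<And>n w. w \<in> ball z s \<Longrightarrow> (f n has_derivative f' n w) (at w)"
    "\<And>n w c v. w \<in> ball z s \<Longrightarrow> f' n w (c *s v) = c * f' n w v"
    by metis
  have Cauchy: "\<exists>N. \<forall>m\<ge>N. \<forall>n\<ge>N. \<forall>w\<in>ball z s. \<forall>v. cmod (f' m w v - f' n w v) \<le> e * norm v"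
    if "e > 0" for e
  proof -
    \<comment> \<open>Two such errors bound \<open>f m - f n\<close> by \<open>e * s / 2\<close>,
      and the Cauchy estimate on balls of radius \<open>s\<close> multiplies this by
      \<open>2 / s\<close>.\<close>
    have "e * s / 4 > 0" using that s by simp
    then obtain N where N: "\<And>n w. n \<ge> N \<Longrightarrow> w \<in> ball z r \<Longrightarrow> dist (f n w) (g w) < e * s / 4"
      using uniform_limitD[OF r(3)] unfolding eventually_sequentially by blast
    have "cmod (f' m w v - f' n w v) \<le> e * norm v" if mn: "m \<ge> N" "n \<ge> N" and w: "w \<in> ball z s" for m n w v
    proof -
      have "cmod (f' m w v - f' n w v) \<le> 2 * (e * s / 2) / s * norm v"
      proof (rule holo_on_derivative_bound[where f = "\<lambda>x. f m x - f n x"])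
        show "holo_on (ball w s) (\<lambda>x. f m x - f n x)"
          using holo s(2)[OF w] r(2) by (intro holo_on_diff; blast intro: holo_on_subset)
        show "cmod (f m x - f n x) \<le> e * s / 2" if "x \<in> ball w s" for x
        proof -
          have "x \<in> ball z r" using s(2)[OF w] that by blast
          from N[OF mn(1) this] N[OF mn(2) this] have "dist (f m x) (f n x) < e * s / 4 + e * s / 4"
            by (metis add_strict_mono dist_commute dist_triangle le_less_trans)
          then show ?thesis by (simp add: dist_norm)
        qed
      qed (use f' w s in \<open>auto intro!: derivative_intros simp: algebra_simps\<close>)
      then show ?thesis using s by simp
    qed
    then show ?thesis by blast
  qed
  define g' where "g' = (\<lambda>w v. lim (\<lambda>n. f' n w v))"
  have g': "(\<lambda>n. f' n w v) \<longlonglongrightarrow> g' w v" if w: "w \<in> ball z s" for w v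
  proof -
    have "Cauchy (\<lambda>n. f' n w v)"
    proof (rule CauchyI)
      fix e :: real assume "e > 0"
      then have "e / (norm v + 1) > 0" by (simp add: add_nonneg_pos)
      then obtain N where N: "\<And>m n. m \<ge> N \<Longrightarrow> n \<ge> N \<Longrightarrow> cmod (f' m w v - f' n w v) \<le> e / (norm v + 1) * norm v"
        using Cauchy w by blast
      have "e / (norm v + 1) * norm v < e"
        using \<open>e > 0\<close> by (simp add: divide_simps add_nonneg_pos)
      then show "\<exists>N. \<forall>m\<ge>N. \<forall>n\<ge>N. cmod (f' m w v - f' n w v) < e"
        using N by (meson le_less_trans)
    qed
    then show ?thesis
      unfolding g'_def by (simp add: Cauchy_convergent_iff convergent_LIMSEQ_iff)
  qed
  \<comment> \<open>Termwise differentiation yields some limit \<open>G\<close>, which is identified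
    with \<open>g\<close> on the ball afterwards by uniqueness of limits.\<close>
  have "\<exists>G. \<forall>w\<in>ball z s. (\<lambda>n. f n w) \<longlonglongrightarrow> G w \<and> (G has_derivative g' w) (at w within ball z s)"
  proof (rule has_derivative_sequence)
    show "(f n has_derivative f' n w) (at w within ball z s)" if "w \<in> ball z s" for n w
      using f'(1)[OF that] has_derivative_at_withinI by blast
    show "\<forall>\<^sub>F n in sequentially. \<forall>w\<in>ball z s. \<forall>v. cmod (f' n w v - g' w v) \<le> e * norm v"
      if "e > 0" for e
    proof -
      obtain N where N: "\<And>m n w v. m \<ge> N \<Longrightarrow> n \<ge> N \<Longrightarrow> w \<in> ball z s \<Longrightarrow> cmod (f' m w v - f' n w v) \<le> e * norm v"
        using Cauchy[OF \<open>e > 0\<close>] by blast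
      have "cmod (f' m w v - g' w v) \<le> e * norm v" if "m \<ge> N" "w \<in> ball z s" for m w v
      proof (rule LIMSEQ_le_const2)
        show "(\<lambda>n. cmod (f' m w v - f' n w v)) \<longlonglongrightarrow> cmod (f' m w v - g' w v)"
          by (intro tendsto_intros g' that)
      qed (use N that in blast)
      then show ?thesis unfolding eventually_sequentially by blast
    qed
    show "(\<lambda>n. f n z) \<longlonglongrightarrow> g z"
      using r by (intro tendsto_uniform_limitI[OF r(3)]) simp
  qed (use s in auto)
  then obtain G where G: "\<And>w. w \<in> ball z s \<Longrightarrow> (\<lambda>n. f n w) \<longlonglongrightarrow> G w"
      "\<And>w. w \<in> ball z s \<Longrightarrow> (G has_derivative g' w) (at w within ball z s)" by blast
  have eq: "G w = g w" if "w \<in> ball z s" for w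
  proof -
    have "w \<in> ball z r" using that r by (simp add: s_def)
    then show ?thesis
      using G(1)[OF that] tendsto_uniform_limitI[OF r(3)] LIMSEQ_unique by blast
  qed
  have "(G has_derivative g' z) (at z)"
    using G(2)[of z] s(1) by (simp add: at_within_open[of z "ball z s"])
  then have "(g has_derivative g' z) (at z)"
    by (rule has_derivative_transform_within_open[of _ _ _ _ "ball z s"]) (use s(1) eq in auto)
  moreover have "g' z (c *s v) = c * g' z v" for c v
  proof (rule LIMSEQ_unique)
    show "(\<lambda>n. f' n z (c *s v)) \<longlonglongrightarrow> g' z (c *s v)" using g' s(1) by simp
    show "(\<lambda>n. f' n z (c *s v)) \<longlonglongrightarrow> c * g' z v"
      unfolding f'(2)[of z, simplified, OF s(1)]
      by (intro tendsto_mult_left g') (simp add: s(1))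
  qed
  ultimately show "\<exists>L. (g has_derivative L) (at z) \<and> (\<forall>c v. L (c *s v) = c * L v)" by blast
qed

text \<open>Restrict to the complex line through \<open>a\<close> and \<open>w\<close>: the
  parameters landing in the ball form a convex open set, so the one-variable identity theorem
  carries equality from near \<open>0\<close>, the point \<open>a\<close>, to \<open>1\<close>, the
  point \<open>w\<close>.\<close>

lemma holo_on_eq_on_ball:
  assumes holo: "holo_on (ball c r) f" "holo_on (ball c r) g"
    and V: "open V" "a \<in> V" "V \<subseteq> ball c r" "\<And>z. z \<in> V \<Longrightarrow> f z = g z"
    and w: "w \<in> ball c r"
  shows "f w = g w"
proof -
  define T where "T = (\<lambda>t. a + t *s (w - a)) -` ball c r"
  define T' where "T' = (\<lambda>t. a + t *s (w - a)) -` V"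
  have cont: "continuous_on UNIV (\<lambda>t. a + t *s (w - a))"
    by (intro continuous_intros linear_continuous_on bounded_linear_smult_left)
  have "f (a + 1 *s (w - a)) = g (a + 1 *s (w - a))"
  proof (rule analytic_continuation_open[of T' T "\<lambda>t. f (a + t *s (w - a))" "\<lambda>t. g (a + t *s (w - a))" 1])
    show "open T'" unfolding T'_def using cont V(1) by (simp add: continuous_open_vimage open_vimage)
    show "open T" unfolding T_def using cont by (simp add: continuous_open_vimage open_vimage)
    have "0 \<in> T'" using V by (simp add: T'_def)
    then show "T' \<noteq> {}" by blast
    have "T = (\<lambda>t. t *s (w - a)) -` ball (c - a) r"
      by (auto simp: T_def dist_norm algebra_simps)
    also have "convex \<dots>"
      by (intro convex_linear_vimage bounded_linear.linear bounded_linear_smult_left convex_ball)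
    finally show "connected T" by (rule convex_connected)
    show "T' \<subseteq> T" using V(3) by (auto simp: T'_def T_def)
    show "(\<lambda>t. f (a + t *s (w - a))) holomorphic_on T" "(\<lambda>t. g (a + t *s (w - a))) holomorphic_on T"
      by (intro holo_on_slice[OF holo(1)] holo_on_slice[OF holo(2)]; simp add: T_def)+
    show "1 \<in> T" using w by (simp add: T_def)
  qed (use V(4) in \<open>auto simp: T'_def\<close>)
  then show ?thesis by simp
qed

text \<open>Let \<open>A\<close> be the interior of the coincidence set. A frontier point of
  \<open>A\<close> in \<open>S\<close> is the centre of a ball in \<open>S\<close> that meets
  \<open>A\<close>, and the identity theorem on balls puts that ball into \<open>A\<close>. So
  \<open>A\<close> has no frontier in the connected set \<open>S\<close>.\<close>

lemma holo_on_identity: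
  assumes holo: "holo_on S f" "holo_on S g" and S: "open S" "connected S"
    and V: "open V" "V \<noteq> {}" "V \<subseteq> S" "\<And>z. z \<in> V \<Longrightarrow> f z = g z"
    and w: "w \<in> S"
  shows "f w = g w"
proof -
  define A where "A = interior {z \<in> S. f z = g z}"
  have "A \<subseteq> S" using interior_subset by (force simp: A_def)
  have "V \<subseteq> A" unfolding A_def using V by (intro interior_maximal) auto
  then have "A \<noteq> {}" using V by blast
  have "S \<inter> frontier A = {}"
  proof (rule ccontr)
    assume "\<not> ?thesis"
    then obtain z where z: "z \<in> S" "z \<in> closure A" "z \<notin> A"
      by (auto simp: frontier_def A_def)
    obtain r where r: "r > 0" "ball z r \<subseteq> S" using S z by (meson openE)
    then obtain a where a: "a \<in> A" "a \<in> ball z r"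
      using z(2) by (auto simp: closure_approachable dist_commute)
    have "f x = g x" if "x \<in> ball z r" for x
    proof (rule holo_on_eq_on_ball[of z r f g "A \<inter> ball z r" a])
      show "f y = g y" if "y \<in> A \<inter> ball z r" for y
        using that interior_subset by (force simp: A_def)
    qed (use holo r a that in \<open>auto intro: holo_on_subset simp: A_def\<close>)
    then have "ball z r \<subseteq> A"
      unfolding A_def using r by (intro interior_maximal) auto
    then show False using z(3) r(1) centre_in_ball by blast
  qed
  then have "S \<subseteq> A"
    using connected_Int_frontier[OF S(2)] \<open>A \<subseteq> S\<close> \<open>A \<noteq> {}\<close> by blast
  then show ?thesis using w interior_subset by (force simp: A_def)
qed

text \<open>Compactness bounds \<open>f\<close> on a closed ball; Cauchy estimates at half the
  radius bound the differentials, and the mean value inequality on the convex ball gives the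
  Lipschitz bound. One \<open>K\<close> serves both bounds, matching the single \<open>m\<close> in
  \<open>Lipschitz_extends\<close>.\<close>

lemma holo_on_locally_Lipschitz:
  fixes f :: "complex ^ 'n \<Rightarrow> complex"
  assumes holo: "holo_on S f" and S: "open S" "z \<in> S"
  obtains r K where "r > 0" "ball z r \<subseteq> S" "\<And>w. w \<in> ball z r \<Longrightarrow> cmod (f w) \<le> K"
    "\<And>x y. x \<in> ball z r \<Longrightarrow> y \<in> ball z r \<Longrightarrow> cmod (f x - f y) \<le> K * norm (x - y)"
proof -
  obtain \<rho> where \<rho>: "\<rho> > 0" "cball z \<rho> \<subseteq> S" using S open_contains_cball by blast
  have "compact (f ` cball z \<rho>)"
    using holo \<rho> by (meson compact_cball compact_continuous_image holo_on_imp_continuous_on holo_on_subset)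
  then obtain M where M: "\<And>w. w \<in> cball z \<rho> \<Longrightarrow> cmod (f w) \<le> M"
    by (metis compact_imp_bounded bounded_iff imageI)
  define r where "r = \<rho> / 2"
  have r: "r > 0" using \<rho> by (simp add: r_def)
  have sub: "ball w r \<subseteq> cball z \<rho>" if "w \<in> ball z r" for w
    using ball_half_subset[of w z \<rho>] that ball_subset_cball by (auto simp: r_def)
  define K where "K = max M (2 * M / r)"
  show ?thesis
  proof
    show "r > 0" by fact
    show "ball z r \<subseteq> S" using \<rho> by (auto simp: r_def)
    show "cmod (f w) \<le> K" if "w \<in> ball z r" for w
      using M[of w] that \<rho>(1) by (auto simp: K_def r_def)
    have "\<forall>w. \<exists>L. w \<in> ball z r \<longrightarrow> (f has_derivative L) (at w) \<and> (\<forall>c v. L (c *s v) = c * L v)"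
      using holo \<open>ball z r \<subseteq> S\<close> unfolding holo_on_def by (meson subsetD)
    then obtain f' where f':
      "\<And>w. w \<in> ball z r \<Longrightarrow> (f has_derivative f' w) (at w)"
      "\<And>w. w \<in> ball z r \<Longrightarrow> \<forall>c v. f' w (c *s v) = c * f' w v"
      by metis
    show "cmod (f x - f y) \<le> K * norm (x - y)" if "x \<in> ball z r" "y \<in> ball z r" for x y
    proof (rule differentiable_bound[OF convex_ball _ _ that])
      show "(f has_derivative f' w) (at w within ball z r)" if "w \<in> ball z r" for w
        using f'(1)[OF that] has_derivative_at_withinI by blast
      show "onorm (f' w) \<le> K" if w: "w \<in> ball z r" for w
      proof (rule onorm_le)
        fix v
        have "cmod (f' w v) \<le> 2 * M / r * norm v"
          using holo sub[OF w] \<rho>(2) r f'[OF w] M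
          by (intro holo_on_derivative_bound[where f = f and z = w]) (auto intro: holo_on_subset)
        also have "\<dots> \<le> K * norm v" by (intro mult_right_mono) (auto simp: K_def)
        finally show "cmod (f' w v) \<le> K * norm v" .
      qed
    qed
  qed
qed

section \<open>The mean value inequality\<close>

text \<open>The image measure is translation invariant. Integrating \<open>1\<^sub>A(x + y) 1\<^sub>B(y)\<close>, with \<open>B\<close> the unit
  ball, against both measures in either order compares their values on \<open>A\<close> with those on \<open>B\<close>, where
  they agree.\<close>

lemma lborel_distr_isometry:
  fixes T :: "'a::euclidean_space \<Rightarrow> 'a"
  assumes lin: "linear T" and surj: "surj T" and iso: "\<And>x. norm (T x) = norm x"
  shows "distr lborel borel T = lborel"
proof -
  define \<mu> where "\<mu> = distr lborel borel T"
  have T_meas [measurable]: "T \<in> borel_measurable borel"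
    using lin by (simp add: borel_measurable_continuous_onI linear_continuous_on linear_conv_bounded_linear)
  have sets_mu [measurable_cong, simp]: "sets \<mu> = sets borel" and [simp]: "space \<mu> = UNIV"
    by (simp_all add: \<mu>_def)
  have ball: "T -` ball 0 r = ball 0 r" for r using iso by auto
  have mu_ball: "emeasure \<mu> (ball 0 r) = emeasure lborel (ball 0 r :: 'a set)" for r
    unfolding \<mu>_def by (simp add: emeasure_distr ball)
  \<comment> \<open>Sigma-finiteness, needed for Fubini, comes from the balls about
    \<open>0\<close>: \<open>T\<close> preserves the norm, so \<open>\<mu>\<close> and Lebesgue
    measure agree on them.\<close>
  interpret mu: sigma_finite_measure \<mu>
  proof
    show "\<exists>A. countable A \<and> A \<subseteq> sets \<mu> \<and> \<Union>A = space \<mu> \<and> (\<forall>a\<in>A. emeasure \<mu> a \<noteq> \<infinity>)"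
    proof (intro exI conjI)
      show "\<Union>(range (\<lambda>n::nat. ball 0 (real n))) = space \<mu>"
        by (auto simp: reals_Archimedean2)
      show "\<forall>a\<in>range (\<lambda>n::nat. ball 0 (real n)). emeasure \<mu> a \<noteq> \<infinity>"
        using emeasure_lborel_ball_finite by (auto simp: mu_ball less_top)
    qed auto
  qed
  interpret P: pair_sigma_finite lborel \<mu> ..
  have transl: "(\<integral>\<^sup>+x. g (x + y) \<partial>\<mu>) = (\<integral>\<^sup>+x. g x \<partial>\<mu>)"
    if [measurable]: "g \<in> borel_measurable borel" for g :: "'a \<Rightarrow> ennreal" and y
  proof -
    \<comment> \<open>By surjectivity, translating by \<open>y\<close> after \<open>T\<close> is
      translating by \<open>u\<close> before \<open>T\<close>.\<close>
    obtain u where u: "y = T u" using surj by blast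
    have "(\<integral>\<^sup>+x. g (x + y) \<partial>\<mu>) = (\<integral>\<^sup>+x. g (T (u + x)) \<partial>lborel)"
      unfolding \<mu>_def u by (simp add: nn_integral_distr linear_add[OF lin] add.commute)
    also have "\<dots> = (\<integral>\<^sup>+x. g (T x) \<partial>distr lborel borel ((+) u))"
      by (simp add: nn_integral_distr)
    also have "\<dots> = (\<integral>\<^sup>+x. g (T x) \<partial>lborel)"
      by (simp add: lborel_distr_plus)
    also have "\<dots> = (\<integral>\<^sup>+x. g x \<partial>\<mu>)"
      unfolding \<mu>_def by (simp add: nn_integral_distr)
    finally show ?thesis .
  qed
  have transl': "(\<integral>\<^sup>+y. g (y + x) \<partial>lborel) = (\<integral>\<^sup>+y. g y \<partial>lborel)"
    if [measurable]: "g \<in> borel_measurable borel" for g :: "'a \<Rightarrow> ennreal" and x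
  proof -
    have "(\<integral>\<^sup>+y. g (y + x) \<partial>lborel) = (\<integral>\<^sup>+y. g y \<partial>distr lborel borel ((+) x))"
      by (simp add: nn_integral_distr add.commute)
    then show ?thesis by (simp add: lborel_distr_plus)
  qed
  have "emeasure \<mu> A = emeasure lborel A" if A [measurable]: "A \<in> sets borel" for A
  proof -
    define B :: "'a set" where "B = ball 0 1"
    have [measurable]: "B \<in> sets borel" by (simp add: B_def)
    have B0: "emeasure lborel B \<noteq> 0" "emeasure lborel B \<noteq> \<infinity>"
      using emeasure_lborel_ball_finite[of "0::'a" 1] content_ball_pos[of 1 "0::'a"]
      by (auto simp: B_def measure_def)
    have "emeasure \<mu> A * emeasure lborel B = (\<integral>\<^sup>+y. emeasure \<mu> A * indicator B y \<partial>lborel)"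
      by (simp add: nn_integral_cmult)
    also have "\<dots> = (\<integral>\<^sup>+y. (\<integral>\<^sup>+x. indicator A (x + y) * indicator B y \<partial>\<mu>) \<partial>lborel)"
      using transl[of "indicator A"] by (simp add: nn_integral_multc)
    also have "\<dots> = (\<integral>\<^sup>+x. (\<integral>\<^sup>+y. indicator A (x + y) * indicator B y \<partial>lborel) \<partial>\<mu>)"
      by (intro P.Fubini'[symmetric]) measurable
    also have "\<dots> = (\<integral>\<^sup>+x. (\<integral>\<^sup>+y. indicator A y * indicator B (x - y) \<partial>lborel) \<partial>\<mu>)"
    proof (rule nn_integral_cong)
      \<comment> \<open>Shift \<open>y\<close> by \<open>x\<close>; since
        \<open>x - (y + x) = - y\<close>, the symmetry of the ball \<open>B\<close> lets the factor
        \<open>indicator B y\<close> be written in the shifted variable.\<close>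
      fix x
      have "(\<integral>\<^sup>+y. indicator A (x + y) * indicator B y \<partial>lborel)
          = (\<integral>\<^sup>+y. indicator A (y + x) * indicator B (x - (y + x)) \<partial>lborel)"
        by (intro nn_integral_cong) (auto simp: indicator_def B_def add.commute)
      also have "\<dots> = (\<integral>\<^sup>+y. indicator A y * indicator B (x - y) \<partial>lborel)"
        by (rule transl'[of "\<lambda>y. indicator A y * indicator B (x - y)"]) measurable
      finally show "(\<integral>\<^sup>+y. indicator A (x + y) * indicator B y \<partial>lborel)
         = (\<integral>\<^sup>+y. indicator A y * indicator B (x - y) \<partial>lborel)" .
    qed
    also have "\<dots> = (\<integral>\<^sup>+y. (\<integral>\<^sup>+x. indicator A y * indicator B (x - y) \<partial>\<mu>) \<partial>lborel)"
      by (intro P.Fubini') measurable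
    also have "\<dots> = (\<integral>\<^sup>+y. indicator A y * emeasure \<mu> B \<partial>lborel)"
      using transl[of "indicator B" "- y" for y] by (simp add: nn_integral_cmult)
    also have "\<dots> = emeasure lborel A * emeasure lborel B"
      using mu_ball[of 1] by (simp add: nn_integral_multc B_def)
    finally have "emeasure \<mu> A * emeasure lborel B = emeasure lborel A * emeasure lborel B" .
    then show ?thesis
      using B0 ennreal_mult_cancel_left[of "emeasure lborel B"]
      by (metis mult.commute infinity_ennreal_def)
  qed
  then show ?thesis
    unfolding \<mu>_def[symmetric] by (intro measure_eqI) auto
qed

text \<open>Cauchy's integral formula at the centre for the slice in direction \<open>w\<close>,
  then the triangle inequality for integrals; \<open>norm w < r\<close> keeps the image of the
  closed unit disc inside the ball.\<close>

lemma holo_mean_value_circle: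
  fixes f :: "complex ^ 'n \<Rightarrow> complex"
  assumes holo: "holo_on (ball z r) f" and w: "norm w < r"
  shows "ennreal (cmod (f z)) \<le>
    (\<integral>\<^sup>+t. ennreal (cmod (f (z + cis (2 * pi * t) *s w))) * indicator {0..1} t \<partial>lborel)"
proof -
  define g where "g = (\<lambda>t. f (z + t *s w))"
  have hol: "g holomorphic_on cball 0 1"
    unfolding g_def
  proof (rule holo_on_slice[OF holo])
    fix t :: complex assume "t \<in> cball 0 1"
    then have "cmod t * norm w \<le> 1 * norm w" by (intro mult_right_mono) auto
    with w show "z + t *s w \<in> ball z r" by (simp add: dist_norm norm_vector_smult)
  qed
  have cont: "continuous_on {0..1} (\<lambda>t. g (cis (2 * pi * t)))"
    by (intro continuous_on_compose2[OF holomorphic_on_imp_continuous_on[OF hol]] continuous_intros) auto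
  have "((\<lambda>u. g u / (u - 0)) has_contour_integral (2 * of_real pi * \<i>) * g 0) (circlepath 0 1)"
    using hol by (intro Cauchy_integral_circlepath) 
      (auto intro: holomorphic_on_subset holomorphic_on_imp_continuous_on)
  \<comment> \<open>The derivative of the circle path is \<open>2 * pi * \<i>\<close> times the path
    itself, and the kernel \<open>1 / u\<close> cancels the path.\<close>
  then have "((\<lambda>t. (2 * of_real pi * \<i>) * g (cis (2 * pi * t))) has_integral (2 * of_real pi * \<i>) * g 0) {0..1}"
    unfolding has_contour_integral
    by (rule has_integral_spike_eq[THEN iffD1, rotated 2])
       (auto simp: vector_derivative_circlepath, auto simp: circlepath cis_conv_exp mult_ac)
  then have int: "((\<lambda>t. g (cis (2 * pi * t))) has_integral g 0) {0..1}"
    using has_integral_mult_right[of "\<lambda>t. (2 * of_real pi * \<i>) * g (cis (2 * pi * t))" "(2 * of_real pi * \<i>) * g 0" "{0..1}" "1 / (2 * of_real pi * \<i>)"] by simp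
  have int2: "(\<lambda>t. cmod (g (cis (2 * pi * t)))) integrable_on {0..1}"
    by (intro integrable_continuous_real continuous_intros cont)
  have "cmod (g 0) \<le> integral {0..1} (\<lambda>t. cmod (g (cis (2 * pi * t))))"
    using integral_norm_bound_integral[OF has_integral_integrable[OF int] int2] integral_unique[OF int] by simp
  also have "ennreal \<dots> = (\<integral>\<^sup>+t\<in>{0..1}. ennreal (cmod (g (cis (2 * pi * t)))) \<partial>lborel)"
    by (rule nn_integral_has_integral_lebesgue'[symmetric]) (auto intro: integrable_integral int2)
  finally show ?thesis
    by (simp add: g_def ennreal_leI)
qed

text \<open>Average the mean value inequality on the circles \<open>z + cis \<theta> *s w\<close> over \<open>w\<close>, using that the
  rotations by \<open>cis \<theta>\<close> preserve Lebesgue measure.\<close>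

lemma holo_mean_value_ball:
  fixes f :: "complex ^ 'n \<Rightarrow> complex"
  assumes holo: "holo_on (ball z r) f" and [measurable]: "f \<in> borel_measurable borel"
  shows "ennreal (cmod (f z)) * emeasure lborel (ball z r)
     \<le> (\<integral>\<^sup>+x\<in>ball z r. ennreal (cmod (f x)) \<partial>lborel)"
proof -
  let ?h = "\<lambda>x. ennreal (cmod (f x))"
  let ?B = "ball 0 r :: (complex ^ 'n) set"
  have [measurable]: "ball c r \<in> sets borel" for c :: "complex ^ 'n"
    by simp
  \<comment> \<open>Joint measurability in \<open>(w, t)\<close> is what allows the integrals to be
    exchanged; written in coordinates, the map is visibly continuous.\<close>
  have [measurable]: "(\<lambda>(w, t). z + cis (2 * pi * t) *s w) \<in> borel_measurable (borel \<Otimes>\<^sub>M borel)"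
  proof -
    have "(\<lambda>(w, t). z + cis (2 * pi * t) *s w)
        = (\<lambda>p. \<chi> i. z $ i + cis (2 * pi * snd p) * fst p $ i)"
      by (auto simp: vec_eq_iff)
    then show ?thesis
      unfolding borel_prod
      by (simp only:) (rule borel_measurable_continuous_onI, intro continuous_intros)
  qed
  have rot: "(\<integral>\<^sup>+w. ?h (z + cis (2 * pi * t) *s w) * indicator ?B w \<partial>lborel)
      = (\<integral>\<^sup>+x\<in>ball z r. ?h x \<partial>lborel)" (is "?l = ?r") for t
  proof -
    define T where "T = (\<lambda>w :: complex ^ 'n. cis (2 * pi * t) *s w)"
    have T: "linear T" "norm (T w) = norm w" for w
      unfolding T_def by (auto simp: linear_smult_right norm_vector_smult)
    have "T (cis (- (2 * pi * t)) *s w) = w" for w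
      by (simp add: T_def cis_mult)
    then have "surj T" by (metis surjI)
    have [measurable]: "T \<in> borel_measurable borel"
      using T by (simp add: borel_measurable_continuous_onI linear_continuous_on linear_conv_bounded_linear)
    have "?l = (\<integral>\<^sup>+w. ?h (z + T w) * indicator ?B (T w) \<partial>lborel)"
      by (intro nn_integral_cong) (auto simp: T_def indicator_def norm_vector_smult)
    also have "\<dots> = (\<integral>\<^sup>+w. ?h (z + w) * indicator ?B w \<partial>distr lborel borel T)"
      by (rule nn_integral_distr[symmetric]) measurable
    also have "\<dots> = (\<integral>\<^sup>+w. ?h (z + w) * indicator ?B w \<partial>lborel)"
      using lborel_distr_isometry[OF T(1) \<open>surj T\<close> T(2)] by simp
    also have "\<dots> = (\<integral>\<^sup>+w. ?h (z + w) * indicator (ball z r) (z + w) \<partial>lborel)"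
      by (intro nn_integral_cong) (auto simp: indicator_def dist_norm)
    also have "\<dots> = (\<integral>\<^sup>+x. ?h x * indicator (ball z r) x \<partial>distr lborel borel ((+) z))"
      by (rule nn_integral_distr[symmetric]) measurable
    finally show ?thesis by (simp add: lborel_distr_plus)
  qed
  have "emeasure lborel (ball z r) = emeasure lborel ?B"
  proof -
    have "emeasure lborel (ball z r) = emeasure (distr lborel borel ((+) z)) (ball z r)"
      by (simp add: lborel_distr_plus)
    also have "\<dots> = emeasure lborel ((+) z -` ball z r)"
      by (simp add: emeasure_distr)
    also have "(+) z -` ball z r = ?B"
      by (auto simp: dist_norm)
    finally show ?thesis .
  qed
  then have "?h z * emeasure lborel (ball z r) = (\<integral>\<^sup>+w\<in>?B. ?h z \<partial>lborel)"
    by (simp add: nn_integral_cmult)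
  also have "\<dots> \<le> (\<integral>\<^sup>+w. (\<integral>\<^sup>+t. ?h (z + cis (2 * pi * t) *s w) * indicator ?B w * indicator {0..1} t \<partial>lborel) \<partial>lborel)"
  proof (rule nn_integral_mono)
    fix w
    show "?h z * indicator ?B w \<le> (\<integral>\<^sup>+t. ?h (z + cis (2 * pi * t) *s w) * indicator ?B w * indicator {0..1} t \<partial>lborel)"
      using holo_mean_value_circle[OF holo, of w] by (auto simp: indicator_def)
  qed
  also have "\<dots> = (\<integral>\<^sup>+t. (\<integral>\<^sup>+w. ?h (z + cis (2 * pi * t) *s w) * indicator ?B w * indicator {0..1} t \<partial>lborel) \<partial>lborel)"
    by (intro lborel_pair.Fubini') measurable
  also have "\<dots> = (\<integral>\<^sup>+t. ?r * indicator {0..1} t \<partial>(lborel :: real measure))"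
  proof (rule nn_integral_cong)
    fix t :: real
    show "(\<integral>\<^sup>+w. ?h (z + cis (2 * pi * t) *s w) * indicator ?B w * indicator {0..1} t \<partial>lborel)
      = ?r * indicator {0..1} t"
      using rot[of t] by (cases "t \<in> {0..1}") simp_all
  qed
  also have "\<dots> = ?r"
    by (simp add: nn_integral_cmult)
  finally show ?thesis .
qed

section \<open>Integral norms\<close>

text \<open>\<open>Lp_norm\<close> applies \<open>enn2real\<close>, which sends an infinite integral
  to \<open>0\<close>; finiteness and limits are therefore tracked with the extended-valued
  integral.\<close>

definition Lp_int :: "real \<Rightarrow> (complex ^ 'n) set \<Rightarrow> (complex ^ 'n \<Rightarrow> complex) \<Rightarrow> ennreal" where
  "Lp_int p \<Omega> f = (\<integral>\<^sup>+ x\<in>\<Omega>. ennreal (cmod (f x) powr p) \<partial>lborel)"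

lemma Lp_norm_nonneg: "0 \<le> Lp_norm p \<Omega> f"
  by (simp add: Lp_norm_def)

lemma Lp_int_eq_norm:
  assumes "p > 0" "Lp_int p \<Omega> f < \<infinity>"
  shows "Lp_int p \<Omega> f = ennreal (Lp_norm p \<Omega> f powr p)"
  using assms by (simp add: Lp_norm_def Lp_int_def[symmetric] powr_powr)

lemma Lp_norm_le:
  assumes "p > 0" "b \<ge> 0" "Lp_int p \<Omega> f \<le> ennreal (b powr p)"
  shows "Lp_norm p \<Omega> f \<le> b"
proof -
  have "enn2real (Lp_int p \<Omega> f) \<le> b powr p"
    using assms(3) by (intro enn2real_leI) auto
  then have "Lp_norm p \<Omega> f \<le> (b powr p) powr (1 / p)"
    unfolding Lp_norm_def Lp_int_def[symmetric] using assms(1) by (intro powr_mono2) auto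
  then show ?thesis using assms by (simp add: powr_powr)
qed

lemma Lp_norm_minus_commute: "Lp_norm p \<Omega> (\<lambda>z. f z - g z) = Lp_norm p \<Omega> (\<lambda>z. g z - f z)"
  by (simp add: Lp_norm_def norm_minus_commute)

text \<open>Convexity of \<open>x powr p\<close> at the points \<open>x / a\<close> and
  \<open>y / b\<close> with weights \<open>a / (a + b)\<close> and \<open>b / (a + b)\<close>. This
  is the pointwise form of Minkowski's inequality, where \<open>a\<close> and \<open>b\<close> stand
  for the two norms.\<close>

lemma powr_add_le:
  fixes x y a b p :: real
  assumes "p \<ge> 1" "x \<ge> 0" "y \<ge> 0" "a > 0" "b > 0"
  shows "(x + y) powr p \<le> (a + b) powr p * (a / (a + b) * (x powr p / a powr p) + b / (a + b) * (y powr p / b powr p))"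
proof -
  define u v where "u = a / (a + b)" and "v = b / (a + b)"
  have uv: "u > 0" "v > 0" "u + v = 1" "u \<le> 1" "v \<le> 1"
    using assms by (auto simp: u_def v_def add_divide_distrib[symmetric])
  have *: "(u * X + v * Y) powr p \<le> u * X powr p + v * Y powr p" if "X \<ge> 0" "Y \<ge> 0" for X Y
  proof -
    \<comment> \<open>Convexity is invoked for positive \<open>X\<close> and \<open>Y\<close>; if
      one of them vanishes, \<open>w powr p \<le> w\<close> for a weight \<open>w \<le> 1\<close> is
      enough.\<close>
    have small: "(w * Z) powr p \<le> w * Z powr p" if "w > 0" "w \<le> 1" "Z \<ge> 0" for w Z :: real
    proof -
      have "w powr p \<le> w powr 1" using that assms(1) by (intro powr_mono') auto
      then show ?thesis using that by (simp add: powr_mult mult_right_mono)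
    qed
    show ?thesis
    proof (cases "X = 0 \<or> Y = 0")
      case True
      then show ?thesis using small uv that assms(1) by fastforce
    next
      case False
      then show ?thesis
        using convex_onD[OF powr_convex[OF assms(1)], of v X Y] that uv
        by (simp add: eq_diff_eq[symmetric])
    qed
  qed
  have "(a + b) * u = a" "(a + b) * v = b"
    using assms by (simp_all add: u_def v_def)
  then have "x + y = (a + b) * (u * (x / a) + v * (y / b))"
    using assms by (simp add: distrib_left mult.assoc[symmetric] del: distrib_right)
  then have "(x + y) powr p = (a + b) powr p * (u * (x / a) + v * (y / b)) powr p"
    using assms uv by (simp add: powr_mult)
  also have "\<dots> \<le> (a + b) powr p * (u * (x / a) powr p + v * (y / b) powr p)"
    using assms by (intro mult_left_mono *) auto
  finally show ?thesis
    using assms by (simp add: powr_divide u_def v_def)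
qed

text \<open>The pointwise inequality integrated, with \<open>a\<close> and \<open>b\<close> left
  free: near the norms they give the triangle inequality, and \<open>a = b = 1\<close> gives
  finiteness of the integral of a sum.\<close>

lemma Lp_int_add_le:
  fixes f g :: "complex ^ 'n \<Rightarrow> complex"
  assumes p: "p \<ge> 1" and ab: "a > 0" "b > 0"
    and [measurable]: "f \<in> borel_measurable borel" "g \<in> borel_measurable borel" "\<Omega> \<in> sets borel"
  shows "Lp_int p \<Omega> (\<lambda>z. f z + g z) \<le> ennreal ((a + b) powr p) *
    (ennreal (a / (a + b) / a powr p) * Lp_int p \<Omega> f + ennreal (b / (a + b) / b powr p) * Lp_int p \<Omega> g)"
proof -
  define A B C where "A = a / (a + b) / a powr p" and "B = b / (a + b) / b powr p" and "C = (a + b) powr p"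
  have ABC: "A \<ge> 0" "B \<ge> 0" "C \<ge> 0" using ab by (auto simp: A_def B_def C_def)
  have "Lp_int p \<Omega> (\<lambda>z. f z + g z) \<le> (\<integral>\<^sup>+x. ennreal C *
     (ennreal A * (ennreal (cmod (f x) powr p) * indicator \<Omega> x)
      + ennreal B * (ennreal (cmod (g x) powr p) * indicator \<Omega> x)) \<partial>lborel)"
    unfolding Lp_int_def
  proof (rule nn_integral_mono)
    fix x
    have "cmod (f x + g x) powr p \<le> (cmod (f x) + cmod (g x)) powr p"
      using p by (intro powr_mono2 norm_triangle_ineq) auto
    also have "\<dots> \<le> C * (A * cmod (f x) powr p + B * cmod (g x) powr p)"
      using powr_add_le[OF p norm_ge_zero norm_ge_zero ab, of "f x" "g x"]
      by (simp add: A_def B_def C_def)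
    finally have "ennreal (cmod (f x + g x) powr p) \<le> ennreal (C * (A * cmod (f x) powr p + B * cmod (g x) powr p))"
      by (rule ennreal_leI)
    also have "\<dots> = ennreal C * (ennreal A * ennreal (cmod (f x) powr p) + ennreal B * ennreal (cmod (g x) powr p))"
      using ABC by (simp add: ennreal_mult)
    finally show "ennreal (cmod (f x + g x) powr p) * indicator \<Omega> x \<le> ennreal C *
       (ennreal A * (ennreal (cmod (f x) powr p) * indicator \<Omega> x)
      + ennreal B * (ennreal (cmod (g x) powr p) * indicator \<Omega> x))"
      by (auto simp: indicator_def)
  qed
  then show ?thesis
    unfolding A_def[symmetric] B_def[symmetric] C_def[symmetric]
    by (simp add: nn_integral_cmult nn_integral_add Lp_int_def)
qed

text \<open>Minkowski's inequality: when \<open>a\<close> and \<open>b\<close> dominate the norms,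
  the two normalised integrals are at most \<open>1\<close>, and the weights add up to
  \<open>1\<close>.\<close>

lemma Lp_norm_triangle:
  fixes f g :: "complex ^ 'n \<Rightarrow> complex"
  assumes p: "p \<ge> 1"
    and meas: "f \<in> borel_measurable borel" "g \<in> borel_measurable borel" "\<Omega> \<in> sets borel"
    and fin: "Lp_int p \<Omega> f < \<infinity>" "Lp_int p \<Omega> g < \<infinity>"
  shows "Lp_norm p \<Omega> (\<lambda>z. f z + g z) \<le> Lp_norm p \<Omega> f + Lp_norm p \<Omega> g"
proof (rule field_le_epsilon)
  fix e :: real assume e: "e > 0"
  \<comment> \<open>The surplus \<open>e / 2\<close> makes \<open>a\<close> and \<open>b\<close>
    positive even if a norm is \<open>0\<close>.\<close>
  define a b where "a = Lp_norm p \<Omega> f + e / 2" and "b = Lp_norm p \<Omega> g + e / 2"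
  have ab: "a > 0" "b > 0" using e Lp_norm_nonneg[of p \<Omega> f] Lp_norm_nonneg[of p \<Omega> g]
    by (auto simp: a_def b_def)
  have fa: "Lp_int p \<Omega> f \<le> ennreal (a powr p)"
    using p fin(1) e by (subst Lp_int_eq_norm) (auto simp: a_def Lp_norm_nonneg intro!: ennreal_leI powr_mono2)
  have gb: "Lp_int p \<Omega> g \<le> ennreal (b powr p)"
    using p fin(2) e by (subst Lp_int_eq_norm) (auto simp: b_def Lp_norm_nonneg intro!: ennreal_leI powr_mono2)
  have "Lp_norm p \<Omega> (\<lambda>z. f z + g z) \<le> a + b"
  proof (rule Lp_norm_le)
    have "Lp_int p \<Omega> (\<lambda>z. f z + g z) \<le> ennreal ((a + b) powr p) *
      (ennreal (a / (a + b) / a powr p) * ennreal (a powr p) + ennreal (b / (a + b) / b powr p) * ennreal (b powr p))"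
      using Lp_int_add_le[OF p ab meas] by (rule order_trans) (intro mult_left_mono add_mono fa gb; simp)
    also have "\<dots> = ennreal ((a + b) powr p) * (ennreal (a / (a + b)) + ennreal (b / (a + b)))"
      using ab by (simp add: ennreal_mult[symmetric])
    also have "ennreal (a / (a + b)) + ennreal (b / (a + b)) = 1"
      using ab by (subst ennreal_plus[symmetric]) (auto simp: add_divide_distrib[symmetric])
    finally show "Lp_int p \<Omega> (\<lambda>z. f z + g z) \<le> ennreal ((a + b) powr p)" by simp
  qed (use p ab in auto)
  then show "Lp_norm p \<Omega> (\<lambda>z. f z + g z) \<le> Lp_norm p \<Omega> f + Lp_norm p \<Omega> g + e"
    by (simp add: a_def b_def)
qed

lemma Lp_int_cmult:
  fixes f :: "complex ^ 'n \<Rightarrow> complex"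
  assumes [measurable]: "f \<in> borel_measurable borel" "\<Omega> \<in> sets borel"
  shows "Lp_int p \<Omega> (\<lambda>z. c * f z) = ennreal (cmod c powr p) * Lp_int p \<Omega> f"
  unfolding Lp_int_def
  by (subst nn_integral_cmult[symmetric])
     (auto simp: norm_mult powr_mult ennreal_mult mult.assoc)

lemma Lp_norm_cmult:
  fixes f :: "complex ^ 'n \<Rightarrow> complex"
  assumes "p > 0" "f \<in> borel_measurable borel" "\<Omega> \<in> sets borel"
  shows "Lp_norm p \<Omega> (\<lambda>z. c * f z) = cmod c * Lp_norm p \<Omega> f"
  unfolding Lp_norm_def Lp_int_def[symmetric] using assms
  by (simp add: Lp_int_cmult enn2real_mult powr_mult powr_powr)

text \<open>Pointwise, \<open>x powr p \<le> 1 + x powr p'\<close>, by comparing \<open>x\<close>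
  with \<open>1\<close>. On a set of finite measure, integrability thus passes to lower
  exponents.\<close>

lemma Lp_int_mono_exponent:
  fixes f :: "complex ^ 'n \<Rightarrow> complex"
  assumes "p \<le> p'" "0 \<le> p"
    and [measurable]: "f \<in> borel_measurable borel" "\<Omega> \<in> sets borel"
  shows "Lp_int p \<Omega> f \<le> emeasure lborel \<Omega> + Lp_int p' \<Omega> f"
proof -
  have "Lp_int p \<Omega> f \<le> (\<integral>\<^sup>+x. indicator \<Omega> x + ennreal (cmod (f x) powr p') * indicator \<Omega> x \<partial>lborel)"
    unfolding Lp_int_def
  proof (rule nn_integral_mono)
    fix x
    have "cmod (f x) powr p \<le> 1 + cmod (f x) powr p'"
    proof (cases "cmod (f x) \<le> 1")
      case True
      then have "cmod (f x) powr p \<le> 1" using assms(2) by (simp add: powr_le1)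
      then show ?thesis by (simp add: add_increasing2)
    next
      case False
      then have "cmod (f x) powr p \<le> cmod (f x) powr p'" using assms(1) by (intro powr_mono) auto
      then show ?thesis by simp
    qed
    then have "ennreal (cmod (f x) powr p) \<le> 1 + ennreal (cmod (f x) powr p')"
      by (metis ennreal_1 ennreal_leI ennreal_plus powr_ge_zero zero_le_one)
    then show "ennreal (cmod (f x) powr p) * indicator \<Omega> x
        \<le> indicator \<Omega> x + ennreal (cmod (f x) powr p') * indicator \<Omega> x"
      by (auto simp: indicator_def)
  qed
  also have "\<dots> = emeasure lborel \<Omega> + Lp_int p' \<Omega> f"
    by (subst nn_integral_add) (auto simp: Lp_int_def)
  finally show ?thesis .
qed

text \<open>The mean value inequality on the ball bounds \<open>cmod (f z)\<close> by an integral of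
  \<open>cmod (f x)\<close>; the elementary estimate
  \<open>x \<le> e + e powr (1 - p) * x powr p\<close> takes the place of Hoelder's inequality. With
  \<open>e\<close> close to the norm, the two terms contribute \<open>1\<close> and
  \<open>1 / V\<close> to the constant.\<close>

lemma holo_point_bound:
  fixes f :: "complex ^ 'n \<Rightarrow> complex"
  assumes p: "p \<ge> 1" and holo: "holo_on (ball z r) f" and r: "r > 0" "ball z r \<subseteq> \<Omega>"
    and [measurable]: "f \<in> borel_measurable borel" "\<Omega> \<in> sets borel"
    and fin: "Lp_int p \<Omega> f < \<infinity>"
  shows "cmod (f z) \<le> (1 + 1 / measure lborel (ball z r)) * Lp_norm p \<Omega> f"
proof -
  define V where "V = measure lborel (ball z r)"
  have V: "V > 0" using r content_ball_pos[of r z] by (simp add: V_def)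
  have eV: "emeasure lborel (ball z r) = ennreal V"
    unfolding V_def by (intro emeasure_eq_ennreal_measure) (use emeasure_lborel_ball_finite[of z r] in auto)
  have [measurable]: "ball z r \<in> sets borel" by simp
  define N where "N = Lp_norm p \<Omega> f"
  have N: "N \<ge> 0" by (simp add: N_def Lp_norm_nonneg)
  have IN: "Lp_int p \<Omega> f = ennreal (N powr p)"
    unfolding N_def using p fin by (intro Lp_int_eq_norm) auto
  have "cmod (f z) / (1 + 1 / V) \<le> N"
  proof (rule dense_ge)
    \<comment> \<open>Proving the bound for every \<open>e > N\<close> keeps \<open>e\<close>
      positive also when \<open>N = 0\<close>.\<close>
    fix e assume "N < e"
    with N have e: "e > 0" by simp
    have "ennreal (cmod (f z)) * ennreal V \<le> (\<integral>\<^sup>+x\<in>ball z r. ennreal (cmod (f x)) \<partial>lborel)"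
      using holo_mean_value_ball[OF holo] eV by simp
    also have "\<dots> \<le> (\<integral>\<^sup>+x. ennreal e * indicator (ball z r) x
        + ennreal (e powr (1 - p)) * (ennreal (cmod (f x) powr p) * indicator \<Omega> x) \<partial>lborel)"
    proof (rule nn_integral_mono)
      fix x
      \<comment> \<open>Values up to \<open>e\<close> are covered by the first term; above
        \<open>e\<close>, the exponent \<open>1 - p \<le> 0\<close> makes
        \<open>cmod (f x) powr (1 - p)\<close> at most \<open>e powr (1 - p)\<close>.\<close>
      have "cmod (f x) \<le> e + e powr (1 - p) * cmod (f x) powr p"
      proof (cases "cmod (f x) \<le> e")
        case True
        then show ?thesis by (simp add: add_increasing2)
      next
        case False
        then have "cmod (f x) = cmod (f x) powr (1 - p) * cmod (f x) powr p"
          using e by (simp add: powr_add[symmetric])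
        also have "\<dots> \<le> e powr (1 - p) * cmod (f x) powr p"
          using False e p by (intro mult_right_mono powr_mono2') auto
        finally show ?thesis using e by simp
      qed
      then have "ennreal (cmod (f x)) \<le> ennreal (e + e powr (1 - p) * cmod (f x) powr p)"
        by (rule ennreal_leI)
      also have "\<dots> = ennreal e + ennreal (e powr (1 - p)) * ennreal (cmod (f x) powr p)"
        using e by (simp add: ennreal_mult)
      finally show "ennreal (cmod (f x)) * indicator (ball z r) x \<le> ennreal e * indicator (ball z r) x
        + ennreal (e powr (1 - p)) * (ennreal (cmod (f x) powr p) * indicator \<Omega> x)"
        using r(2) by (auto simp: indicator_def)
    qed
    also have "\<dots> = ennreal e * ennreal V + ennreal (e powr (1 - p)) * ennreal (N powr p)"
      unfolding IN[symmetric] eV[symmetric]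
      by (subst nn_integral_add) (auto simp: Lp_int_def nn_integral_cmult)
    also have "\<dots> = ennreal (e * V + e powr (1 - p) * N powr p)"
      using e V by (simp add: ennreal_mult)
    finally have "cmod (f z) * V \<le> e * V + e powr (1 - p) * N powr p"
      using e V by (simp add: ennreal_mult[symmetric] del: ennreal_plus)
    also have "e powr (1 - p) * N powr p \<le> e powr (1 - p) * e powr p"
      using \<open>N < e\<close> N p by (intro mult_left_mono powr_mono2) auto
    also have "\<dots> = e" using e by (simp add: powr_add[symmetric])
    finally show "cmod (f z) / (1 + 1 / V) \<le> e"
      using V by (simp add: field_simps)
  qed
  then show ?thesis
    unfolding V_def[symmetric] N_def[symmetric] using V by (simp add: field_simps)
qed

section \<open>Measurability, finiteness and limits of the integrals\<close>

lemma borel_measurable_holo_on: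
  fixes f :: "complex ^ 'n \<Rightarrow> complex"
  assumes "open \<Omega>" "holo_on \<Omega> f" "\<And>x. x \<notin> \<Omega> \<Longrightarrow> f x = 0"
  shows "f \<in> borel_measurable borel"
proof -
  have "(\<lambda>x. indicator \<Omega> x *\<^sub>R f x) \<in> borel_measurable borel"
    using assms by (intro borel_measurable_continuous_on_indicator holo_on_imp_continuous_on) auto
  moreover have "(\<lambda>x. indicator \<Omega> x *\<^sub>R f x) = f"
    using assms(3) by (auto simp: indicator_def)
  ultimately show ?thesis by simp
qed

lemma Lp_int_add_finite:
  fixes f g :: "complex ^ 'n \<Rightarrow> complex"
  assumes "p \<ge> 1" "f \<in> borel_measurable borel" "g \<in> borel_measurable borel" "\<Omega> \<in> sets borel"
    and "Lp_int p \<Omega> f < \<infinity>" "Lp_int p \<Omega> g < \<infinity>"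
  shows "Lp_int p \<Omega> (\<lambda>z. f z + g z) < \<infinity>"
proof -
  have "ennreal A * (ennreal B * x + ennreal C * y) < \<infinity>" if "x < \<infinity>" "y < \<infinity>" for A B C x y
    using that by (auto simp: ennreal_mult_less_top)
  then show ?thesis
    using Lp_int_add_le[of p 1 1 f g \<Omega>] assms by (meson le_less_trans zero_less_one)
qed

text \<open>Fatou's lemma: an integral bound survives pointwise limits without a dominating
  function. It turns Cauchy bounds into convergence in the completeness proof.\<close>

lemma Lp_int_Fatou:
  fixes f :: "nat \<Rightarrow> complex ^ 'n \<Rightarrow> complex"
  assumes [measurable]: "\<And>m. f m \<in> borel_measurable borel" "\<Omega> \<in> sets borel"
    and p: "p > 0"
    and lim: "\<And>z. z \<in> \<Omega> \<Longrightarrow> (\<lambda>m. f m z) \<longlonglongrightarrow> g z"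
    and le: "\<forall>\<^sub>F m in sequentially. Lp_int p \<Omega> (f m) \<le> C"
  shows "Lp_int p \<Omega> g \<le> C"
proof -
  have "Lp_int p \<Omega> g = (\<integral>\<^sup>+x. liminf (\<lambda>m. ennreal (cmod (f m x) powr p) * indicator \<Omega> x) \<partial>lborel)"
    unfolding Lp_int_def
  proof (rule nn_integral_cong)
    fix x
    have "(\<lambda>m. ennreal (cmod (f m x) powr p) * indicator \<Omega> x) \<longlonglongrightarrow> ennreal (cmod (g x) powr p) * indicator \<Omega> x"
    proof (cases "x \<in> \<Omega>")
      case True
      then show ?thesis
        using p by (auto intro!: tendsto_ennrealI tendsto_powr' tendsto_norm lim)
    qed simp
    then show "ennreal (cmod (g x) powr p) * indicator \<Omega> x = liminf (\<lambda>m. ennreal (cmod (f m x) powr p) * indicator \<Omega> x)"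
      by (metis lim_imp_Liminf trivial_limit_sequentially)
  qed
  also have "\<dots> \<le> liminf (\<lambda>m. Lp_int p \<Omega> (f m))"
    unfolding Lp_int_def by (rule nn_integral_liminf) measurable
  also have "\<dots> \<le> C"
    using le by (intro Liminf_le) auto
  finally show ?thesis .
qed

section \<open>The metric space\<close>

lemma frac_bounds:
  fixes x :: real assumes "x \<ge> 0"
  shows "0 \<le> x / (1 + x)" "x / (1 + x) \<le> 1"
  using assms by (auto simp: field_simps)

lemma frac_mono: "0 \<le> x \<Longrightarrow> x \<le> y \<Longrightarrow> x / (1 + x) \<le> y / (1 + y)" for x y :: real
  by (simp add: field_simps)

lemma frac_subadditive:
  fixes x y z :: real
  assumes "0 \<le> x" "0 \<le> y" "0 \<le> z" "z \<le> x + y"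
  shows "z / (1 + z) \<le> x / (1 + x) + y / (1 + y)"
proof -
  have "z / (1 + z) \<le> (x + y) / (1 + (x + y))" using assms by (intro frac_mono) auto
  also have "\<dots> = x / (1 + (x + y)) + y / (1 + (x + y))" by (simp add: add_divide_distrib)
  also have "\<dots> \<le> x / (1 + x) + y / (1 + y)"
    using assms by (intro add_mono divide_left_mono mult_pos_pos) auto
  finally show ?thesis .
qed

lemma OLdist_term_bound:
  fixes x :: real assumes "x \<ge> 0"
  shows "norm ((1/2) ^ k * (x / (1 + x))) \<le> (1/2) ^ k"
proof -
  have "norm ((1/2) ^ k * (x / (1 + x))) = (1/2) ^ k * (x / (1 + x))"
    using assms by simp
  also have "\<dots> \<le> (1/2) ^ k * 1"
    by (intro mult_left_mono frac_bounds assms) simp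
  finally show ?thesis by simp
qed

lemma OLdist_summable:
  "summable (\<lambda>j. (1/2) ^ (Suc j) * (Lp_norm (ps j) \<Omega> f / (1 + Lp_norm (ps j) \<Omega> f)))"
proof (rule summable_comparison_test')
  show "summable (\<lambda>j. (1/2 :: real) ^ (Suc j))" by (simp add: summable_geometric)
  show "norm ((1/2) ^ (Suc j) * (Lp_norm (ps j) \<Omega> f / (1 + Lp_norm (ps j) \<Omega> f))) \<le> (1/2) ^ (Suc j)" if "j \<ge> 0" for j
    by (intro OLdist_term_bound Lp_norm_nonneg)
qed

lemma OLdist_nonneg: "0 \<le> OLdist ps \<Omega> f g"
  unfolding OLdist_def
  by (intro suminf_nonneg[OF OLdist_summable] mult_nonneg_nonneg frac_bounds Lp_norm_nonneg) auto

lemma OLdist_commute: "OLdist ps \<Omega> f g = OLdist ps \<Omega> g f"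
  unfolding OLdist_def by (simp add: Lp_norm_minus_commute[of _ _ f g])

text \<open>One term of a nonnegative series is at most its sum, and \<open>x / (1 + x)\<close> is
  increasing. The same \<open>\<delta>\<close> works for all pairs of functions.\<close>

lemma Lp_norm_small_if_OLdist_small:
  assumes "e > 0"
  shows "\<exists>\<delta>>0. \<forall>f g. OLdist ps \<Omega> f g < \<delta> \<longrightarrow> Lp_norm (ps j) \<Omega> (\<lambda>z. f z - g z) < e"
proof (intro exI conjI allI impI)
  \<comment> \<open>The value of the \<open>j\<close>-th term of the series for a norm equal to
    \<open>e\<close>.\<close>
  define \<delta> where "\<delta> = (1/2) ^ Suc j * (e / (1 + e))"
  show "\<delta> > 0" using assms by (simp add: \<delta>_def)
  fix f g assume "OLdist ps \<Omega> f g < \<delta>"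
  let ?N = "Lp_norm (ps j) \<Omega> (\<lambda>z. f z - g z)"
  have "sum (\<lambda>j. (1/2) ^ (Suc j) * (Lp_norm (ps j) \<Omega> (\<lambda>z. f z - g z) / (1 + Lp_norm (ps j) \<Omega> (\<lambda>z. f z - g z)))) {j}
     \<le> OLdist ps \<Omega> f g"
    unfolding OLdist_def
    by (intro sum_le_suminf OLdist_summable mult_nonneg_nonneg frac_bounds Lp_norm_nonneg) auto
  then have "(1/2) ^ Suc j * (?N / (1 + ?N)) < (1/2) ^ Suc j * (e / (1 + e))"
    using \<open>OLdist ps \<Omega> f g < \<delta>\<close> by (simp add: \<delta>_def)
  then have "?N / (1 + ?N) < e / (1 + e)"
    by (simp only: mult_less_cancel_left_pos zero_less_power half_gt_zero_iff zero_less_one)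
  then show "?N < e"
    using frac_mono[of e ?N] assms by linarith
qed

text \<open>Dominated convergence for series (Tannery), with the geometric series as
  majorant.\<close>

lemma OLdist_tendsto_0:
  assumes "\<And>j. (\<lambda>n. Lp_norm (ps j) \<Omega> (\<lambda>z. f n z - g z)) \<longlonglongrightarrow> 0"
  shows "(\<lambda>n. OLdist ps \<Omega> (f n) g) \<longlonglongrightarrow> 0"
proof -
  let ?N = "\<lambda>j n. Lp_norm (ps j) \<Omega> (\<lambda>z. f n z - g z)"
  have "(\<lambda>n. \<Sum>j. (1/2) ^ Suc j * (?N j n / (1 + ?N j n))) \<longlonglongrightarrow> (\<Sum>j. 0)"
  proof (rule tannerys_theorem[THEN conjunct2, THEN conjunct2])
    show "(\<lambda>n. (1/2) ^ Suc j * (?N j n / (1 + ?N j n))) \<longlonglongrightarrow> 0" for j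
      by (rule tendsto_eq_intros refl assms | simp)+
    show "\<forall>\<^sub>F (j, n) in sequentially \<times>\<^sub>F sequentially.
        norm ((1/2) ^ Suc j * (?N j n / (1 + ?N j n))) \<le> (1/2) ^ Suc j"
    proof (intro always_eventually allI, clarify)
      fix j n
      show "norm ((1/2) ^ Suc j * (?N j n / (1 + ?N j n))) \<le> (1/2) ^ Suc j"
        by (intro OLdist_term_bound Lp_norm_nonneg)
    qed
    show "summable (\<lambda>j. (1/2 :: real) ^ (Suc j))" by (simp add: summable_geometric)
  qed simp
  then show ?thesis by (simp add: OLdist_def)
qed

locale OL_space =
  fixes \<Omega> :: "(complex ^ 'n) set" and q :: ereal and ps :: "nat \<Rightarrow> real"
  assumes bounded_dom: "bounded \<Omega>" and open_dom: "open \<Omega>" and adm: "admissible_seq q ps"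
begin

abbreviation "X \<equiv> OLq q \<Omega>"

lemma dom_borel [measurable]: "\<Omega> \<in> sets borel"
  using open_dom by simp

lemma ps_gt_1: "1 < ps j"
proof -
  have "ps 0 \<le> ps j" using adm by (simp add: admissible_seq_def strict_mono_less_eq)
  then show ?thesis using adm by (simp add: admissible_seq_def)
qed

text \<open>Every \<open>p\<close> below \<open>q\<close> lies below some \<open>ps j\<close>, as
  these tend to \<open>q\<close>, and the bounded set \<open>\<Omega>\<close> has finite measure; so
  the exponents of the sequence already decide membership.\<close>

lemma OLq_iff: "f \<in> X \<longleftrightarrow> holo_on \<Omega> f \<and> (\<forall>x. x \<notin> \<Omega> \<longrightarrow> f x = 0) \<and> (\<forall>j. Lp_int (ps j) \<Omega> f < \<infinity>)"
proof -
  have meas: "f \<in> borel_measurable borel" if "holo_on \<Omega> f" "\<forall>x. x \<notin> \<Omega> \<longrightarrow> f x = 0"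
    using borel_measurable_holo_on[OF open_dom] that by blast
  have "Lp_int p \<Omega> f < \<infinity>"
    if "f \<in> borel_measurable borel" "\<forall>j. Lp_int (ps j) \<Omega> f < \<infinity>" "1 \<le> p" "ereal p < q" for p
  proof -
    have "\<forall>\<^sub>F j in sequentially. ereal p < ereal (ps j)"
      using adm that(4) by (auto simp: admissible_seq_def dest: order_tendstoD(1))
    then obtain j where "ereal p < ereal (ps j)"
      using eventually_happens'[OF sequentially_bot] by blast
    then have j: "p \<le> ps j" by simp
    have "Lp_int p \<Omega> f \<le> emeasure lborel \<Omega> + Lp_int (ps j) \<Omega> f"
      using that j by (intro Lp_int_mono_exponent) auto
    also have "\<dots> < \<infinity>"
      using emeasure_bounded_finite[OF bounded_dom] that(2) by simp
    finally show ?thesis .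
  qed
  then show ?thesis
    using meas ps_gt_1 adm unfolding OLq_def Lp_int_def[symmetric] admissible_seq_def
    by (auto simp: less_imp_le)
qed

lemma OLq_measurable: "f \<in> X \<Longrightarrow> f \<in> borel_measurable borel"
  using borel_measurable_holo_on[OF open_dom] by (auto simp: OLq_iff)

lemma OLq_add: "f \<in> X \<Longrightarrow> g \<in> X \<Longrightarrow> (\<lambda>z. f z + g z) \<in> X"
  using OLq_measurable[of f] OLq_measurable[of g] ps_gt_1 Lp_int_add_finite[of _ f g \<Omega>]
  by (simp add: OLq_iff holo_on_add less_imp_le)

lemma OLq_cmult: "f \<in> X \<Longrightarrow> (\<lambda>z. c * f z) \<in> X"
  using OLq_measurable[of f]
  by (auto simp: OLq_iff holo_on_cmult Lp_int_cmult ennreal_mult_less_top)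

lemma OLq_diff: "f \<in> X \<Longrightarrow> g \<in> X \<Longrightarrow> (\<lambda>z. f z - g z) \<in> X"
  using OLq_add[of f "\<lambda>z. (-1) * g z"] OLq_cmult[of g "-1"] by simp

text \<open>All balls of radius \<open>s / 2\<close> centred in the half ball lie in
  \<open>\<Omega>\<close> and have the same volume, so the constant of
  \<open>holo_point_bound\<close> is uniform there.\<close>

lemma OLq_uniform_bound:
  assumes "z \<in> \<Omega>"
  obtains r K where "r > 0" "ball z r \<subseteq> \<Omega>"
    "\<And>f w. f \<in> X \<Longrightarrow> w \<in> ball z r \<Longrightarrow> cmod (f w) \<le> K * Lp_norm (ps 0) \<Omega> f" "K > 0"
proof -
  obtain s where s: "s > 0" "ball z s \<subseteq> \<Omega>" using open_dom assms by (meson openE)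
  show ?thesis
  proof
    show "s / 2 > 0" using s by simp
    show "ball z (s / 2) \<subseteq> \<Omega>" using s by auto
    show "1 + 1 / measure lborel (ball z (s / 2)) > 0"
      by (simp add: add_pos_nonneg)
    fix f w assume f: "f \<in> X" and w: "w \<in> ball z (s / 2)"
    have sub: "ball w (s / 2) \<subseteq> \<Omega>" using ball_half_subset[OF w] s by blast
    have "measure lborel (ball w (s / 2)) = measure lborel (ball z (s / 2))"
      using s by (simp add: content_ball)
    moreover have "cmod (f w) \<le> (1 + 1 / measure lborel (ball w (s / 2))) * Lp_norm (ps 0) \<Omega> f"
      using f ps_gt_1[of 0] s sub
      by (intro holo_point_bound OLq_measurable) (auto simp: OLq_iff intro: holo_on_subset)
    ultimately show "cmod (f w) \<le> (1 + 1 / measure lborel (ball z (s / 2))) * Lp_norm (ps 0) \<Omega> f"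
      by simp
  qed
qed

text \<open>The uniform bound applied to \<open>f - g\<close>. Definiteness of the metric and both
  openness lemmas below rest on this.\<close>

lemma evaluation_continuous:
  assumes "z \<in> \<Omega>" "e > 0"
  shows "\<exists>\<delta>>0. \<forall>f\<in>X. \<forall>g\<in>X. OLdist ps \<Omega> f g < \<delta> \<longrightarrow> cmod (f z - g z) < e"
proof -
  obtain r K where K: "r > 0" "\<And>f w. f \<in> X \<Longrightarrow> w \<in> ball z r \<Longrightarrow> cmod (f w) \<le> K * Lp_norm (ps 0) \<Omega> f" "K > 0"
    using OLq_uniform_bound[OF assms(1)] by metis
  obtain \<delta> where \<delta>: "\<delta> > 0" "\<And>f g. OLdist ps \<Omega> f g < \<delta> \<Longrightarrow> Lp_norm (ps 0) \<Omega> (\<lambda>z. f z - g z) < e / K"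
    using Lp_norm_small_if_OLdist_small[of "e / K" ps \<Omega> 0] assms K by auto
  have "cmod (f z - g z) < e" if "f \<in> X" "g \<in> X" "OLdist ps \<Omega> f g < \<delta>" for f g
  proof -
    have "cmod (f z - g z) \<le> K * Lp_norm (ps 0) \<Omega> (\<lambda>z. f z - g z)"
      using K(2)[OF OLq_diff[OF that(1,2)], of z] K(1) by simp
    also have "\<dots> < K * (e / K)" using \<delta>(2)[OF that(3)] K(3) by (intro mult_strict_left_mono)
    finally show ?thesis using K by simp
  qed
  then show ?thesis using \<delta>(1) by blast
qed

sublocale M: Metric_space X "OLdist ps \<Omega>"
proof
  fix f g h :: "complex ^ 'n \<Rightarrow> complex"
  show "0 \<le> OLdist ps \<Omega> f g" by (rule OLdist_nonneg)
  show "OLdist ps \<Omega> f g = OLdist ps \<Omega> g f" by (rule OLdist_commute)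
  show "(OLdist ps \<Omega> f g = 0) = (f = g)" if fg: "f \<in> X" "g \<in> X"
  proof
    assume d0: "OLdist ps \<Omega> f g = 0"
    \<comment> \<open>Inside \<open>\<Omega>\<close>, evaluation is continuous for the metric;
      outside, both functions are \<open>0\<close> by the normalisation in
      \<open>OLq\<close>.\<close>
    have "f z = g z" for z
    proof (cases "z \<in> \<Omega>")
      case True
      have "cmod (f z - g z) \<le> 0"
      proof (rule dense_ge)
        fix e :: real assume "0 < e"
        then show "cmod (f z - g z) \<le> e"
          using evaluation_continuous[OF True, of e] fg d0 by fastforce
      qed
      then show ?thesis by simp
    qed (use fg in \<open>auto simp: OLq_iff\<close>)
    then show "f = g" by blast
  qed (simp add: OLdist_def Lp_norm_def)
  show "OLdist ps \<Omega> f h \<le> OLdist ps \<Omega> f g + OLdist ps \<Omega> g h" if fgh: "f \<in> X" "g \<in> X" "h \<in> X"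
    unfolding OLdist_def suminf_add[OF OLdist_summable OLdist_summable]
  proof (intro suminf_le summable_add OLdist_summable)
    fix j
    have "Lp_norm (ps j) \<Omega> (\<lambda>z. (f z - g z) + (g z - h z))
        \<le> Lp_norm (ps j) \<Omega> (\<lambda>z. f z - g z) + Lp_norm (ps j) \<Omega> (\<lambda>z. g z - h z)"
      using ps_gt_1[of j] fgh OLq_diff[of f g] OLq_diff[of g h]
      by (intro Lp_norm_triangle OLq_measurable) (auto simp: OLq_iff)
    then have "(1/2) ^ Suc j * (Lp_norm (ps j) \<Omega> (\<lambda>z. f z - h z) / (1 + Lp_norm (ps j) \<Omega> (\<lambda>z. f z - h z)))
      \<le> (1/2) ^ Suc j * (Lp_norm (ps j) \<Omega> (\<lambda>z. f z - g z) / (1 + Lp_norm (ps j) \<Omega> (\<lambda>z. f z - g z))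
         + Lp_norm (ps j) \<Omega> (\<lambda>z. g z - h z) / (1 + Lp_norm (ps j) \<Omega> (\<lambda>z. g z - h z)))"
      by (intro mult_left_mono frac_subadditive Lp_norm_nonneg) auto
    then show "(1/2) ^ Suc j * (Lp_norm (ps j) \<Omega> (\<lambda>z. f z - h z) / (1 + Lp_norm (ps j) \<Omega> (\<lambda>z. f z - h z)))
      \<le> (1/2) ^ Suc j * (Lp_norm (ps j) \<Omega> (\<lambda>z. f z - g z) / (1 + Lp_norm (ps j) \<Omega> (\<lambda>z. f z - g z)))
       + (1/2) ^ Suc j * (Lp_norm (ps j) \<Omega> (\<lambda>z. g z - h z) / (1 + Lp_norm (ps j) \<Omega> (\<lambda>z. g z - h z)))"
      by (simp only: distrib_left)
  qed
qed

text \<open>A Cauchy sequence is locally uniformly Cauchy by the point bound, so it has a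
  holomorphic limit \<open>F\<close> by Weierstrass' theorem; Fatou's lemma then upgrades this to
  convergence in every norm.\<close>

lemma mcomplete: "M.mcomplete"
  unfolding M.mcomplete_def
proof (intro allI impI)
  fix \<sigma> assume Cauchy: "M.MCauchy \<sigma>"
  then have X: "\<sigma> n \<in> X" for n by (auto simp: M.MCauchy_def)
  have CN: "\<exists>N. \<forall>n\<ge>N. \<forall>m\<ge>N. Lp_norm (ps j) \<Omega> (\<lambda>z. \<sigma> n z - \<sigma> m z) < e" if "e > 0" for e j
  proof -
    obtain \<delta> where "\<delta> > 0" "\<And>f g. OLdist ps \<Omega> f g < \<delta> \<Longrightarrow> Lp_norm (ps j) \<Omega> (\<lambda>z. f z - g z) < e"
      using Lp_norm_small_if_OLdist_small[OF \<open>e > 0\<close>, of ps \<Omega> j] by auto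
    then show ?thesis using Cauchy unfolding M.MCauchy_def by meson
  qed
  define F where "F = (\<lambda>z. lim (\<lambda>n. \<sigma> n z))"
  have loc: "\<exists>r>0. ball z r \<subseteq> \<Omega> \<and> uniform_limit (ball z r) \<sigma> F sequentially" if z: "z \<in> \<Omega>" for z
  proof -
    obtain r K where K: "r > 0" "ball z r \<subseteq> \<Omega>"
      "\<And>f w. f \<in> X \<Longrightarrow> w \<in> ball z r \<Longrightarrow> cmod (f w) \<le> K * Lp_norm (ps 0) \<Omega> f" "K > 0"
      using OLq_uniform_bound[OF z] by metis
    have "uniformly_Cauchy_on (ball z r) \<sigma>"
      unfolding uniformly_Cauchy_on_def
    proof (intro allI impI)
      fix e :: real assume "e > 0"
      then have "e / K > 0" using K by simp
      then obtain N where N: "\<And>n m. n \<ge> N \<Longrightarrow> m \<ge> N \<Longrightarrow> Lp_norm (ps 0) \<Omega> (\<lambda>z. \<sigma> n z - \<sigma> m z) < e / K"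
        using CN by blast
      have "dist (\<sigma> m w) (\<sigma> n w) < e" if "w \<in> ball z r" "m \<ge> N" "n \<ge> N" for w m n
      proof -
        have "cmod (\<sigma> m w - \<sigma> n w) \<le> K * Lp_norm (ps 0) \<Omega> (\<lambda>z. \<sigma> m z - \<sigma> n z)"
          using K(3)[OF OLq_diff[OF X X] that(1)] .
        also have "\<dots> < K * (e / K)" using N that K(4) by (intro mult_strict_left_mono)
        finally show ?thesis using K by (simp add: dist_norm)
      qed
      then show "\<exists>M. \<forall>x\<in>ball z r. \<forall>m\<ge>M. \<forall>n\<ge>M. dist (\<sigma> m x) (\<sigma> n x) < e" by blast
    qed
    then have "uniform_limit (ball z r) \<sigma> F sequentially"
      unfolding F_def uniformly_convergent_uniform_limit_iff[symmetric]
      by (rule Cauchy_uniformly_convergent)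
    then show ?thesis using K by blast
  qed
  have lim: "(\<lambda>n. \<sigma> n z) \<longlonglongrightarrow> F z" if "z \<in> \<Omega>" for z
    using loc[OF that] by (metis centre_in_ball tendsto_uniform_limitI)
  have holoF: "holo_on \<Omega> F"
    by (rule holo_on_uniform_limit[OF _ loc]) (use X in \<open>simp_all add: OLq_iff\<close>)
  \<comment> \<open>Off \<open>\<Omega>\<close> the sequence is constantly \<open>0\<close>, so
    \<open>lim\<close> returns \<open>0\<close> and \<open>F\<close> is normalised.\<close>
  have F0: "F z = 0" if "z \<notin> \<Omega>" for z
    using X that by (simp add: F_def OLq_iff)
  \<comment> \<open>Fix \<open>n\<close> and let \<open>m\<close> tend to infinity in the Cauchy
    bound.\<close>
  have FN: "\<exists>N. \<forall>n\<ge>N. Lp_int (ps j) \<Omega> (\<lambda>z. \<sigma> n z - F z) \<le> ennreal (e powr ps j)" if e: "e > 0" for e j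
  proof -
    obtain N where N: "\<And>n m. n \<ge> N \<Longrightarrow> m \<ge> N \<Longrightarrow> Lp_norm (ps j) \<Omega> (\<lambda>z. \<sigma> n z - \<sigma> m z) < e"
      using CN[OF e] by blast
    have "Lp_int (ps j) \<Omega> (\<lambda>z. \<sigma> n z - F z) \<le> ennreal (e powr ps j)" if n: "n \<ge> N" for n
    proof (rule Lp_int_Fatou)
      show "(\<lambda>z. \<sigma> n z - \<sigma> m z) \<in> borel_measurable borel" for m
        using X by (intro OLq_measurable OLq_diff)
      show "(\<lambda>m. \<sigma> n z - \<sigma> m z) \<longlonglongrightarrow> \<sigma> n z - F z" if "z \<in> \<Omega>" for z
        using lim[OF that] by (intro tendsto_intros)
      have "Lp_int (ps j) \<Omega> (\<lambda>z. \<sigma> n z - \<sigma> m z) \<le> ennreal (e powr ps j)" if "m \<ge> N" for m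
      proof -
        have "Lp_int (ps j) \<Omega> (\<lambda>z. \<sigma> n z - \<sigma> m z) = ennreal (Lp_norm (ps j) \<Omega> (\<lambda>z. \<sigma> n z - \<sigma> m z) powr ps j)"
          using OLq_diff[OF X X] ps_gt_1[of j] by (intro Lp_int_eq_norm) (auto simp: OLq_iff)
        also have "\<dots> \<le> ennreal (e powr ps j)"
          using N[OF n that] ps_gt_1[of j] by (intro ennreal_leI powr_mono2) (auto simp: Lp_norm_nonneg)
        finally show ?thesis .
      qed
      then show "\<forall>\<^sub>F m in sequentially. Lp_int (ps j) \<Omega> (\<lambda>z. \<sigma> n z - \<sigma> m z) \<le> ennreal (e powr ps j)"
        unfolding eventually_sequentially by blast
    qed (use ps_gt_1[of j] in auto)
    then show ?thesis by blast
  qed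
  have FX: "F \<in> X"
  proof -
    have meas: "F \<in> borel_measurable borel"
      using open_dom holoF F0 by (rule borel_measurable_holo_on)
    have "Lp_int (ps j) \<Omega> F < \<infinity>" for j
    proof -
      obtain n where "Lp_int (ps j) \<Omega> (\<lambda>z. \<sigma> n z - F z) \<le> ennreal (1 powr ps j)"
        using FN[of 1 j] by auto
      then have "Lp_int (ps j) \<Omega> (\<lambda>z. F z - \<sigma> n z) < \<infinity>"
        by (simp add: Lp_int_def norm_minus_commute le_less_trans)
      then have "Lp_int (ps j) \<Omega> (\<lambda>z. (F z - \<sigma> n z) + \<sigma> n z) < \<infinity>"
        using ps_gt_1[of j] meas X[of n] OLq_measurable[OF X[of n]]
        by (intro Lp_int_add_finite) (auto simp: OLq_iff)
      then show ?thesis by simp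
    qed
    then show ?thesis using holoF F0 by (auto simp: OLq_iff)
  qed
  have "(\<lambda>n. OLdist ps \<Omega> (\<sigma> n) F) \<longlonglongrightarrow> 0"
  proof (intro OLdist_tendsto_0 LIMSEQ_I)
    fix j and e :: real assume "e > 0"
    then obtain N where N: "\<And>n. n \<ge> N \<Longrightarrow> Lp_int (ps j) \<Omega> (\<lambda>z. \<sigma> n z - F z) \<le> ennreal ((e / 2) powr ps j)"
      using FN[of "e / 2" j] by auto
    have "Lp_norm (ps j) \<Omega> (\<lambda>z. \<sigma> n z - F z) \<le> e / 2" if "n \<ge> N" for n
      using N[OF that] \<open>e > 0\<close> ps_gt_1[of j] by (intro Lp_norm_le) auto
    then show "\<exists>N. \<forall>n\<ge>N. norm (Lp_norm (ps j) \<Omega> (\<lambda>z. \<sigma> n z - F z) - 0) < e"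
      using \<open>e > 0\<close> by (intro exI[of _ N]) (force simp: Lp_norm_nonneg)
  qed
  then have "limitin M.mtopology \<sigma> F sequentially"
    using FX X by (simp add: M.limitin_metric_dist_null)
  then show "\<exists>x. limitin M.mtopology \<sigma> x sequentially" by blast
qed

end

section \<open>Components near the boundary\<close>

text \<open>The connected set \<open>U\<close> meets \<open>E\<close> without being contained in it,
  hence meets the frontier of \<open>E\<close>. Such a point cannot lie in \<open>\<Omega>\<close>,
  for adjoining it to \<open>E\<close> would give a larger connected subset of
  \<open>U \<inter> \<Omega>\<close>.\<close>

lemma component_accumulates_at_frontier:
  fixes U \<Omega> :: "'a::real_normed_vector set"
  assumes "open U" "connected U" "open \<Omega>" "\<not> U \<subseteq> \<Omega>" and E: "E \<in> components (U \<inter> \<Omega>)"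
  obtains \<zeta> where "\<zeta> \<in> U" "\<zeta> \<in> frontier \<Omega>" "\<zeta> \<in> closure E"
proof -
  have sub: "E \<subseteq> U \<inter> \<Omega>" and ne: "E \<noteq> {}" and "connected E"
    using E by (auto dest: in_components_subset in_components_nonempty in_components_connected)
  have "open E" using E assms by (intro open_components[OF _ E]) auto
  have "U \<inter> frontier E \<noteq> {}"
    using assms sub ne by (intro connected_Int_frontier) auto
  then obtain \<zeta> where \<zeta>: "\<zeta> \<in> U" "\<zeta> \<in> closure E" "\<zeta> \<notin> E"
    using \<open>open E\<close> by (auto simp: frontier_def interior_open)
  have "\<zeta> \<notin> \<Omega>"
  proof
    assume "\<zeta> \<in> \<Omega>"
    have "connected (insert \<zeta> E)"
    proof (rule connected_intermediate_closure)
      show "insert \<zeta> E \<subseteq> closure E" using \<zeta>(2) closure_subset by blast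
    qed (use \<open>connected E\<close> in auto)
    then have "insert \<zeta> E \<subseteq> E"
      by (rule components_maximal[OF E]) (use \<zeta>(1) \<open>\<zeta> \<in> \<Omega>\<close> sub ne in auto)
    then show False using \<zeta>(3) by blast
  qed
  moreover have "\<zeta> \<in> closure \<Omega>" using \<zeta>(2) sub closure_mono[of E \<Omega>] by blast
  ultimately have "\<zeta> \<in> frontier \<Omega>" using assms(3) by (simp add: frontier_def interior_open)
  then show ?thesis using that \<zeta> by blast
qed

text \<open>The last clause reduces conditions on uncountably many components to countably many:
  each component reaching the boundary contains a member of the family as close to that boundary
  point as desired. The closed ball there gives control up to the boundary of the test ball.\<close>

definition boundary_test_family :: "'a::metric_space set \<Rightarrow> ('a \<times> real \<times> 'a set) set \<Rightarrow> bool" where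
  "boundary_test_family \<Omega> I \<longleftrightarrow> countable I
     \<and> (\<forall>(c, r, E)\<in>I. r > 0 \<and> \<not> ball c r \<subseteq> \<Omega> \<and> E \<in> components (ball c r \<inter> \<Omega>))
     \<and> (\<forall>U E W \<zeta>. E \<in> components (U \<inter> \<Omega>) \<and> \<zeta> \<in> closure E \<and> \<zeta> \<notin> \<Omega> \<and> open W \<and> \<zeta> \<in> W \<and> W \<subseteq> U
          \<longrightarrow> (\<exists>(c, r, E')\<in>I. cball c r \<subseteq> W \<and> E' \<subseteq> E))"

lemma boundary_test_familyD:
  assumes "boundary_test_family \<Omega> I" "(c, r, E) \<in> I"
  shows "r > 0" "\<not> ball c r \<subseteq> \<Omega>" "E \<in> components (ball c r \<inter> \<Omega>)" "E \<subseteq> ball c r \<inter> \<Omega>"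
proof -
  show *: "r > 0" "\<not> ball c r \<subseteq> \<Omega>" "E \<in> components (ball c r \<inter> \<Omega>)"
    using assms unfolding boundary_test_family_def by blast+
  show "E \<subseteq> ball c r \<inter> \<Omega>" using *(3) by (rule in_components_subset)
qed

lemma boundary_test_familyE:
  assumes "boundary_test_family \<Omega> I" "E \<in> components (U \<inter> \<Omega>)" "\<zeta> \<in> closure E" "\<zeta> \<in> frontier \<Omega>"
    "open \<Omega>" "open W" "\<zeta> \<in> W" "W \<subseteq> U"
  obtains c r E' where "(c, r, E') \<in> I" "cball c r \<subseteq> W" "E' \<subseteq> E"
proof -
  have "\<zeta> \<notin> \<Omega>" using assms by (simp add: frontier_def interior_open)
  then have "\<exists>(c, r, E')\<in>I. cball c r \<subseteq> W \<and> E' \<subseteq> E"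
    using assms unfolding boundary_test_family_def by meson
  then show ?thesis using that by blast
qed

text \<open>Centres come from a countable dense set and radii from the rationals, and each component
  is named by a dense point \<open>d\<close> in it; this makes the family countable.\<close>

lemma boundary_test_family_exists:
  fixes \<Omega> :: "'a::euclidean_space set"
  assumes "open \<Omega>"
  shows "\<exists>I. boundary_test_family \<Omega> I"
proof -
  obtain D :: "'a set" where D: "countable D" "\<And>S. open S \<Longrightarrow> S \<noteq> {} \<Longrightarrow> \<exists>d\<in>D. d \<in> S"
    using countable_dense_setE by blast
  define J where "J = {(c, r, d). c \<in> D \<and> r \<in> \<rat> \<and> d \<in> D \<and> r > 0 \<and> \<not> ball c r \<subseteq> \<Omega> \<and> d \<in> ball c r \<inter> \<Omega>}"
  define I where "I = (\<lambda>(c, r, d). (c, r, connected_component_set (ball c r \<inter> \<Omega>) d)) ` J"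
  have "J \<subseteq> D \<times> (\<rat> \<times> D)" by (auto simp: J_def)
  then have "countable J"
    using D(1) countable_rat by (meson countable_SIGMA countable_subset)
  have "\<exists>(c, r, E')\<in>I. cball c r \<subseteq> W \<and> E' \<subseteq> E"
    if E: "E \<in> components (U \<inter> \<Omega>)" and \<zeta>: "\<zeta> \<in> closure E" "\<zeta> \<notin> \<Omega>" and W: "open W" "\<zeta> \<in> W" "W \<subseteq> U"
    for U E W \<zeta>
  proof -
    obtain e where e: "e > 0" "ball \<zeta> e \<subseteq> W" using W by (meson openE)
    \<comment> \<open>With \<open>dist \<zeta> c < e / 4\<close>, the bound \<open>e / 4 < r\<close>
      puts \<open>\<zeta>\<close> into \<open>ball c r\<close>, and \<open>r < e / 2\<close> keeps
      \<open>cball c r\<close> inside \<open>ball \<zeta> e\<close>.\<close>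
    obtain r where r: "r \<in> \<rat>" "e / 4 < r" "r < e / 2"
      using Rats_dense_in_real[of "e / 4" "e / 2"] e by auto
    obtain c where c: "c \<in> D" "dist \<zeta> c < e / 4"
      using D(2)[of "ball \<zeta> (e / 4)"] e by auto
    have in_ball: "\<zeta> \<in> ball c r" using c r by (simp add: dist_commute)
    have cball: "cball c r \<subseteq> W"
    proof
      fix x assume "x \<in> cball c r"
      then have "dist \<zeta> x < e" using dist_triangle[of \<zeta> x c] c(2) r e by auto
      then show "x \<in> W" using e by auto
    qed
    have sub: "E \<subseteq> U \<inter> \<Omega>" using E by (rule in_components_subset)
    obtain y where y: "y \<in> E" "y \<in> ball c r"
      using \<zeta>(1) in_ball by (meson closure_iff_nhds_not_empty disjoint_iff open_ball order_refl)
    then obtain \<epsilon> where \<epsilon>: "\<epsilon> > 0" "ball y \<epsilon> \<subseteq> ball c r \<inter> \<Omega>"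
      using assms sub openE[of "ball c r \<inter> \<Omega>" y] by blast
    \<comment> \<open>A ball about \<open>y \<in> E\<close> inside
      \<open>U \<inter> \<Omega>\<close> is connected, so it stays in \<open>E\<close> and supplies
      a dense point there.\<close>
    have "ball y \<epsilon> \<subseteq> E"
    proof (rule components_maximal[OF E connected_ball])
      show "ball y \<epsilon> \<subseteq> U \<inter> \<Omega>"
        using \<epsilon>(2) cball W(3) ball_subset_cball[of c r] by blast
      show "E \<inter> ball y \<epsilon> \<noteq> {}" using \<epsilon>(1) y(1) centre_in_ball by blast
    qed
    then have "\<exists>d\<in>D. d \<in> ball c r \<inter> E"
      using D(2)[of "ball y \<epsilon>"] \<epsilon> by fastforce
    then obtain d where d: "d \<in> D" "d \<in> ball c r" "d \<in> E" by blast
    define E' where "E' = connected_component_set (ball c r \<inter> \<Omega>) d"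
    have "(c, r, E') \<in> I"
      unfolding I_def E'_def using c d r e in_ball \<zeta>(2) sub
      by (intro image_eqI[of _ _ "(c, r, d)"]) (auto simp: J_def)
    moreover have "E' \<subseteq> E"
    proof (rule components_maximal[OF E])
      show "connected E'" by (simp add: E'_def)
      show "E' \<subseteq> U \<inter> \<Omega>"
        using connected_component_subset[of "ball c r \<inter> \<Omega>" d] cball W(3) ball_subset_cball[of c r]
        unfolding E'_def by blast
      have "d \<in> E'" using d sub by (auto simp: E'_def connected_component_refl_eq)
      then show "E \<inter> E' \<noteq> {}" using d by blast
    qed
    ultimately show ?thesis using cball by blast
  qed
  moreover have "countable I" unfolding I_def using \<open>countable J\<close> by simp
  moreover have "\<forall>(c, r, E)\<in>I. r > 0 \<and> \<not> ball c r \<subseteq> \<Omega> \<and> E \<in> components (ball c r \<inter> \<Omega>)"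
    by (auto simp: I_def J_def components_def)
  ultimately have "boundary_test_family \<Omega> I"
    unfolding boundary_test_family_def by blast
  then show ?thesis ..
qed

text \<open>The Lipschitz bound up to the boundary of the ball makes this condition closed in \<open>h\<close>
  by a single application of Arzela-Ascoli, without passing to smaller balls.\<close>

definition Lipschitz_extends :: "complex ^ 'n \<Rightarrow> real \<Rightarrow> (complex ^ 'n) set \<Rightarrow> real \<Rightarrow> (complex ^ 'n \<Rightarrow> complex) \<Rightarrow> bool" where
  "Lipschitz_extends c r E m h \<longleftrightarrow> (\<exists>F. holo_on (ball c r) F \<and> (\<forall>z\<in>cball c r. cmod (F z) \<le> m)
     \<and> (\<forall>x\<in>cball c r. \<forall>y\<in>cball c r. cmod (F x - F y) \<le> m * norm (x - y)) \<and> (\<forall>z\<in>E. F z = h z))"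

text \<open>The extensions are equibounded and equi-Lipschitz on the compact ball, so a subsequence
  converges uniformly. Its limit is holomorphic, inherits both bounds, and equals \<open>h\<close>
  on \<open>E\<close>.\<close>

lemma Lipschitz_extends_limit:
  fixes h :: "complex ^ 'n \<Rightarrow> complex"
  assumes "\<And>k. Lipschitz_extends c r E m (g k)" and r: "r > 0" and E: "E \<subseteq> ball c r"
    and lim: "\<And>z. z \<in> E \<Longrightarrow> (\<lambda>k. g k z) \<longlonglongrightarrow> h z"
  shows "Lipschitz_extends c r E m h"
proof -
  obtain F where F: "\<And>k. holo_on (ball c r) (F k)" "\<And>k z. z \<in> cball c r \<Longrightarrow> cmod (F k z) \<le> m"
    "\<And>k x y. x \<in> cball c r \<Longrightarrow> y \<in> cball c r \<Longrightarrow> cmod (F k x - F k y) \<le> m * norm (x - y)"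
    "\<And>k z. z \<in> E \<Longrightarrow> F k z = g k z"
    using assms(1) unfolding Lipschitz_extends_def by metis
  \<comment> \<open>The sign of \<open>m\<close> is read off from the bound at the centre;
    \<open>e / (m + 1)\<close> below depends on it.\<close>
  have "cmod (F 0 c) \<le> m" using F(2) r by simp
  then have m: "m \<ge> 0" using norm_ge_zero order_trans by blast
  obtain G k where G: "continuous_on (cball c r) G" "strict_mono (k :: nat \<Rightarrow> nat)"
     "\<And>e. 0 < e \<Longrightarrow> \<exists>N. \<forall>n x. n \<ge> N \<and> x \<in> cball c r \<longrightarrow> norm (F (k n) x - G x) < e"
  proof (rule Arzela_Ascoli[of "cball c r" F m])
    show "\<exists>d>0. \<forall>n y. y \<in> cball c r \<and> norm (x - y) < d \<longrightarrow> norm (F n x - F n y) < e"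
      if x: "x \<in> cball c r" and e: "0 < e" for x e
    proof (intro exI conjI allI impI)
      show "e / (m + 1) > 0" using e m by simp
      fix n y assume y: "y \<in> cball c r \<and> norm (x - y) < e / (m + 1)"
      have "norm (F n x - F n y) \<le> m * norm (x - y)" using F(3) x y by blast
      also have "\<dots> \<le> m * (e / (m + 1))" using y m by (intro mult_left_mono) auto
      also have "\<dots> < e" using e m by (simp add: field_simps)
      finally show "norm (F n x - F n y) < e" .
    qed
  qed (use F(2) in auto)
  have unif: "uniform_limit (cball c r) (\<lambda>n. F (k n)) G sequentially"
    unfolding uniform_limit_sequentially_iff dist_norm using G(3) by blast
  have ptw: "(\<lambda>n. F (k n) z) \<longlonglongrightarrow> G z" if "z \<in> cball c r" for z
    using tendsto_uniform_limitI[OF unif that] .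
  show ?thesis
    unfolding Lipschitz_extends_def
  proof (intro exI conjI ballI)
    show "holo_on (ball c r) G"
    proof (rule holo_on_uniform_limit)
      show "holo_on (ball c r) (F (k n))" for n by (rule F(1))
      fix z assume "z \<in> ball c r"
      then obtain s where s: "s > 0" "ball z s \<subseteq> ball c r" by (meson open_ball openE)
      moreover have "uniform_limit (ball z s) (\<lambda>n. F (k n)) G sequentially"
        using s ball_subset_cball by (intro uniform_limit_on_subset[OF unif]) blast
      ultimately show "\<exists>s>0. ball z s \<subseteq> ball c r \<and> uniform_limit (ball z s) (\<lambda>n. F (k n)) G sequentially"
        by blast
    qed
    show "cmod (G z) \<le> m" if "z \<in> cball c r" for z
      by (rule LIMSEQ_le_const2[OF tendsto_norm[OF ptw[OF that]]]) (use F(2) that in blast)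
    show "cmod (G x - G y) \<le> m * norm (x - y)" if "x \<in> cball c r" "y \<in> cball c r" for x y
      by (rule LIMSEQ_le_const2[OF tendsto_norm[OF tendsto_diff[OF ptw[OF that(1)] ptw[OF that(2)]]]])
         (use F(3) that in blast)
    show "G z = h z" if z: "z \<in> E" for z
    proof (rule LIMSEQ_unique)
      show "(\<lambda>n. F (k n) z) \<longlonglongrightarrow> G z" using z E ptw ball_subset_cball by blast
      show "(\<lambda>n. F (k n) z) \<longlonglongrightarrow> h z"
        using LIMSEQ_subseq_LIMSEQ[OF lim[OF z] G(2)] F(4)[OF z] by (simp add: o_def)
    qed
  qed
qed

text \<open>A forbidden extension \<open>F\<close> agrees with \<open>h\<close> on a whole component
  \<open>E\<close> of \<open>U \<inter> \<Omega>\<close>. This \<open>E\<close> reaches a boundary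
  point in \<open>U\<close>, near which \<open>F\<close> is bounded and Lipschitz, and a test ball
  fits into that neighbourhood.\<close>

lemma not_singular_imp_Lipschitz_extends:
  fixes \<Omega> :: "(complex ^ 'n) set"
  assumes dom: "open \<Omega>" and holo: "holo_on \<Omega> h" and ns: "\<not> singular_at_boundary \<Omega> h"
    and I: "boundary_test_family \<Omega> I"
  shows "\<exists>c r E. \<exists>m::nat. (c, r, E) \<in> I \<and> Lipschitz_extends c r E m h"
proof -
  obtain U V F where U: "open U" "open V" "connected U" "V \<noteq> {}" "V \<subseteq> U \<inter> \<Omega>" "U \<inter> \<Omega> \<noteq> U"
    and F: "holo_on U F" "\<And>z. z \<in> V \<Longrightarrow> F z = h z"
    using ns unfolding singular_at_boundary_def by blast
  obtain v where v: "v \<in> V" using U by blast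
  define E where "E = connected_component_set (U \<inter> \<Omega>) v"
  have vE: "v \<in> U \<inter> \<Omega>" using v U by blast
  have E: "E \<in> components (U \<inter> \<Omega>)" using vE by (auto simp: E_def components_def)
  have sub: "E \<subseteq> U \<inter> \<Omega>" using E by (rule in_components_subset)
  have "open E" using E U dom by (intro open_components[OF _ E]) auto
  have FE: "F z = h z" if "z \<in> E" for z
  proof (rule holo_on_identity[of E F h "V \<inter> E"])
    have "v \<in> E" using vE by (simp add: E_def connected_component_refl_eq)
    then show "V \<inter> E \<noteq> {}" using v by blast
    show "connected E" by (simp add: E_def)
    show "open (V \<inter> E)" using U \<open>open E\<close> by blast
  qed (use F holo sub \<open>open E\<close> that in \<open>auto intro: holo_on_subset\<close>)
  obtain \<zeta> where \<zeta>: "\<zeta> \<in> U" "\<zeta> \<in> frontier \<Omega>" "\<zeta> \<in> closure E"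
    using component_accumulates_at_frontier[OF U(1,3) dom _ E] U(6) by blast
  obtain r K where r: "r > 0" "ball \<zeta> r \<subseteq> U" "\<And>w. w \<in> ball \<zeta> r \<Longrightarrow> cmod (F w) \<le> K"
    "\<And>x y. x \<in> ball \<zeta> r \<Longrightarrow> y \<in> ball \<zeta> r \<Longrightarrow> cmod (F x - F y) \<le> K * norm (x - y)"
    using holo_on_locally_Lipschitz[OF F(1) U(1) \<zeta>(1)] by metis
  obtain m :: nat where m: "K \<le> m" using real_arch_simple by blast
  obtain c s E' where cs: "(c, s, E') \<in> I" "cball c s \<subseteq> ball \<zeta> r" "E' \<subseteq> E"
    using boundary_test_familyE[OF I E \<zeta>(3,2) dom open_ball[of \<zeta> r]] r by auto
  have "Lipschitz_extends c s E' m h"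
    unfolding Lipschitz_extends_def
  proof (intro exI[of _ F] conjI ballI)
    show "holo_on (ball c s) F"
      using F(1) cs(2) r(2) ball_subset_cball by (blast intro: holo_on_subset)
    show "cmod (F z) \<le> m" if "z \<in> cball c s" for z
      using r(3)[of z] that cs(2) m by auto
    show "cmod (F x - F y) \<le> m * norm (x - y)" if "x \<in> cball c s" "y \<in> cball c s" for x y
    proof -
      have "cmod (F x - F y) \<le> K * norm (x - y)" using r(4) that cs(2) by blast
      also have "\<dots> \<le> m * norm (x - y)" using m by (intro mult_right_mono) auto
      finally show ?thesis .
    qed
  qed (use FE cs in blast)
  then show ?thesis using cs(1) by blast
qed

text \<open>\<open>ball c r\<close> and \<open>E\<close> themselves serve as \<open>U\<close> and
  \<open>V\<close> in the definition of singularity.\<close>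

lemma singular_imp_not_Lipschitz_extends:
  assumes "open \<Omega>" "\<not> ball c r \<subseteq> \<Omega>" and E: "E \<in> components (ball c r \<inter> \<Omega>)"
    and "singular_at_boundary \<Omega> h"
  shows "\<not> Lipschitz_extends c r E m h"
proof
  assume "Lipschitz_extends c r E m h"
  then obtain F where F: "holo_on (ball c r) F" "\<forall>z\<in>E. F z = h z"
    unfolding Lipschitz_extends_def by blast
  have "open E" using assms(1) by (intro open_components[OF _ E]) auto
  moreover have "E \<noteq> {}" "E \<subseteq> ball c r \<inter> \<Omega>"
    using E by (auto dest: in_components_subset in_components_nonempty)
  moreover have "ball c r \<inter> \<Omega> \<noteq> ball c r" using assms(2) by blast
  ultimately show False
    using assms(4) F unfolding singular_at_boundary_def
    by (metis connected_ball open_ball)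
qed

section \<open>Total unboundedness expressed through the test family\<close>

lemma SUP_cmod_eq_infinity_iff:
  "(SUP z\<in>E. ereal (cmod (f z))) = \<infinity> \<longleftrightarrow> (\<forall>m::nat. \<exists>z\<in>E. real m < cmod (f z))"
proof
  assume *: "(SUP z\<in>E. ereal (cmod (f z))) = \<infinity>"
  show "\<forall>m::nat. \<exists>z\<in>E. real m < cmod (f z)"
  proof
    fix m :: nat
    have "ereal m < (SUP z\<in>E. ereal (cmod (f z)))" unfolding * by simp
    then show "\<exists>z\<in>E. real m < cmod (f z)" by (simp add: less_SUP_iff)
  qed
next
  assume *: "\<forall>m::nat. \<exists>z\<in>E. real m < cmod (f z)"
  show "(SUP z\<in>E. ereal (cmod (f z))) = \<infinity>"
  proof (rule SUP_PInfty)
    fix n :: nat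
    show "\<exists>z\<in>E. ereal (real n) \<le> ereal (cmod (f z))"
      using * by (force intro: less_imp_le)
  qed
qed

text \<open>Unboundedness passes from a set to any larger one, so each direction finds a component
  of the other kind inside the given one: a component for a small ball centred on the boundary
  inside a test component, and conversely a test component inside any component of the
  definition.\<close>

lemma totally_unbounded_iff:
  fixes \<Omega> :: "(complex ^ 'n) set"
  assumes dom: "open \<Omega>"
    and I: "boundary_test_family \<Omega> I"
  shows "totally_unbounded \<Omega> f \<longleftrightarrow> (\<forall>(c, r, E)\<in>I. \<forall>m::nat. \<exists>z\<in>E. real m < cmod (f z))"
proof
  assume tu: "totally_unbounded \<Omega> f"
  have "\<exists>z\<in>E. real m < cmod (f z)" if "(c, r, E) \<in> I" for c r E and m :: nat
  proof -
    have E: "\<not> ball c r \<subseteq> \<Omega>" "E \<in> components (ball c r \<inter> \<Omega>)"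
      using boundary_test_familyD[OF I that] by auto
    obtain \<zeta> where \<zeta>: "\<zeta> \<in> ball c r" "\<zeta> \<in> frontier \<Omega>" "\<zeta> \<in> closure E"
      using component_accumulates_at_frontier[OF open_ball connected_ball dom E] by blast
    obtain \<delta> where \<delta>: "\<delta> > 0" "ball \<zeta> \<delta> \<subseteq> ball c r" using \<zeta>(1) by (meson open_ball openE)
    obtain x where x: "x \<in> E" "x \<in> ball \<zeta> \<delta>"
      using \<zeta>(3) \<delta>(1) by (auto simp: closure_approachable dist_commute)
    have sub: "E \<subseteq> ball c r \<inter> \<Omega>" using E(2) by (rule in_components_subset)
    define E' where "E' = connected_component_set (ball \<zeta> \<delta> \<inter> \<Omega>) x"
    have x2: "x \<in> ball \<zeta> \<delta> \<inter> \<Omega>" using x sub by blast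
    have "E' \<in> components (ball \<zeta> \<delta> \<inter> \<Omega>)" using x2 by (auto simp: E'_def components_def)
    then have "\<exists>z\<in>E'. real m < cmod (f z)"
      using tu \<zeta>(2) \<delta>(1) unfolding totally_unbounded_def SUP_cmod_eq_infinity_iff by blast
    moreover have "E' \<subseteq> E"
    proof (rule components_maximal[OF E(2)])
      show "connected E'" by (simp add: E'_def)
      show "E' \<subseteq> ball c r \<inter> \<Omega>"
        using connected_component_subset[of "ball \<zeta> \<delta> \<inter> \<Omega>" x] \<delta>(2) by (auto simp: E'_def)
      have "x \<in> E'" using x2 by (simp add: E'_def connected_component_refl_eq)
      then show "E \<inter> E' \<noteq> {}" using x by blast
    qed
    ultimately show ?thesis by blast
  qed
  then show "\<forall>(c, r, E)\<in>I. \<forall>m::nat. \<exists>z\<in>E. real m < cmod (f z)" by blast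
next
  assume *: "\<forall>(c, r, E)\<in>I. \<forall>m::nat. \<exists>z\<in>E. real m < cmod (f z)"
  show "totally_unbounded \<Omega> f"
    unfolding totally_unbounded_def SUP_cmod_eq_infinity_iff
  proof (intro ballI allI impI)
    fix w \<delta> E and m :: nat
    assume w: "w \<in> frontier \<Omega>" and \<delta>: "0 < (\<delta>::real)" and E: "E \<in> components (ball w \<delta> \<inter> \<Omega>)"
    have "w \<notin> \<Omega>" using w dom by (simp add: frontier_def interior_open)
    then have "\<not> ball w \<delta> \<subseteq> \<Omega>" using \<delta> by (meson centre_in_ball subsetD)
    then obtain \<zeta> where \<zeta>: "\<zeta> \<in> ball w \<delta>" "\<zeta> \<in> frontier \<Omega>" "\<zeta> \<in> closure E"
      using component_accumulates_at_frontier[OF open_ball connected_ball dom _ E] by blast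
    obtain c r E' where "(c, r, E') \<in> I" "E' \<subseteq> E"
      using boundary_test_familyE[OF I E \<zeta>(3,2) dom open_ball \<zeta>(1) order_refl] by metis
    then show "\<exists>z\<in>E. real m < cmod (f z)" using * by blast
  qed
qed

section \<open>Density and $G_\delta$ sets\<close>

context OL_space
begin

section \<open>Agreement with the metric topology; open and dense conditions\<close>

lemma OL_open_iff: "OL_open q ps \<Omega> U \<longleftrightarrow> openin M.mtopology U"
proof -
  have "(\<forall>g\<in>X. OLdist ps \<Omega> f g < e \<longrightarrow> g \<in> U) \<longleftrightarrow> M.mball f e \<subseteq> U" if "f \<in> X" for f e
    using that by (auto simp: M.mball_def)
  then show ?thesis
    unfolding OL_open_def M.openin_mtopology Ball_def by (meson subsetD)
qed

lemma OL_dense_iff: "OL_dense q ps \<Omega> A \<longleftrightarrow> A \<subseteq> X \<and> M.mtopology closure_of A = X"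
proof -
  have "M.mtopology closure_of A = {f \<in> X. \<forall>e>0. \<exists>g\<in>A. OLdist ps \<Omega> f g < e}" if "A \<subseteq> X"
    unfolding M.metric_closure_of using that by (auto simp: subset_iff)
  then show ?thesis unfolding OL_dense_def by blast
qed

lemma OL_open_whole: "OL_open q ps \<Omega> X"
  unfolding OL_open_def by (auto intro: exI[of _ 1])

lemma OL_GdeltaI:
  assumes "countable J" "\<And>i. i \<in> J \<Longrightarrow> OL_open q ps \<Omega> (U i)" "A = X \<inter> (\<Inter>i\<in>J. U i)"
  shows "OL_Gdelta q ps \<Omega> A"
proof -
  \<comment> \<open>Adding \<open>X\<close> keeps the family nonempty, hence enumerable by
    \<open>nat\<close>, even if \<open>J\<close> is empty, as happens for empty
    \<open>\<Omega>\<close>.\<close>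
  define \<G> where "\<G> = insert X (U ` J)"
  have "countable \<G>" "\<G> \<noteq> {}" using assms by (auto simp: \<G>_def)
  then obtain V :: "nat \<Rightarrow> (complex ^ 'n \<Rightarrow> complex) set" where V: "range V = \<G>"
    by (metis uncountable_def)
  have "OL_open q ps \<Omega> (V k)" for k
  proof -
    have "V k \<in> \<G>" using V by blast
    then show ?thesis using assms(2) OL_open_whole by (auto simp: \<G>_def)
  qed
  moreover have "A = (\<Inter>k. V k)" using assms(3) V by (simp add: \<G>_def)
  ultimately show ?thesis unfolding OL_Gdelta_def by blast
qed

lemma open_exceeds:
  assumes "E \<subseteq> \<Omega>"
  shows "OL_open q ps \<Omega> {g \<in> X. \<exists>z\<in>E. m < cmod (g z)}"
  unfolding OL_open_def
proof (intro conjI ballI)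
  fix f assume "f \<in> {g \<in> X. \<exists>z\<in>E. m < cmod (g z)}"
  then obtain z where f: "f \<in> X" and z: "z \<in> E" "m < cmod (f z)" by blast
  obtain \<delta> where \<delta>: "\<delta> > 0" "\<forall>f'\<in>X. \<forall>g\<in>X. OLdist ps \<Omega> f' g < \<delta> \<longrightarrow> cmod (f' z - g z) < cmod (f z) - m"
    using evaluation_continuous[of z "cmod (f z) - m"] z assms by auto
  have "m < cmod (g z)" if "g \<in> X" "OLdist ps \<Omega> f g < \<delta>" for g
  proof -
    have "cmod (f z - g z) < cmod (f z) - m" using \<delta>(2) f that by blast
    then show ?thesis using norm_triangle_ineq2[of "f z" "g z"] by linarith
  qed
  then show "\<exists>e>0. \<forall>g\<in>X. OLdist ps \<Omega> f g < e \<longrightarrow> g \<in> {g \<in> X. \<exists>z\<in>E. m < cmod (g z)}"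
    using \<delta>(1) z by blast
qed auto

text \<open>If \<open>f\<close> stays below \<open>m\<close> on \<open>E\<close>, add
  \<open>k / (n + 1)\<close>: its norms tend to \<open>0\<close>, while \<open>k\<close> is
  unbounded on \<open>E\<close> because \<open>E\<close> approaches \<open>\<zeta>\<close> within
  \<open>\<Omega>\<close>.\<close>

lemma dense_exceeds:
  assumes \<zeta>: "\<zeta> \<in> closure E" "\<zeta> \<notin> \<Omega>" "E \<subseteq> \<Omega>"
    and k: "k \<in> X" "filterlim k at_infinity (at \<zeta> within \<Omega>)"
  shows "OL_dense q ps \<Omega> {g \<in> X. \<exists>z\<in>E. m < cmod (g z)}"
  unfolding OL_dense_def
proof (intro conjI ballI allI impI)
  fix f and e :: real assume f: "f \<in> X" and "e > 0"
  have unb: "\<exists>z\<in>E. B < cmod (k z)" for B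
  proof -
    have "\<forall>\<^sub>F z in at \<zeta> within \<Omega>. B + 1 \<le> cmod (k z)"
      using filterlim_at_infinity_imp_norm_at_top[OF k(2)] unfolding filterlim_at_top by blast
    then obtain d where d: "d > 0" "\<And>z. z \<in> \<Omega> \<Longrightarrow> z \<noteq> \<zeta> \<Longrightarrow> dist z \<zeta> < d \<Longrightarrow> B + 1 \<le> cmod (k z)"
      unfolding eventually_at by auto
    obtain z where "z \<in> E" "dist z \<zeta> < d" using \<zeta>(1) d(1) by (auto simp: closure_approachable)
    then have "B + 1 \<le> cmod (k z)" using d(2) \<zeta> by blast
    then show ?thesis using \<open>z \<in> E\<close> by (intro bexI[of _ z]) auto
  qed
  show "\<exists>g\<in>{g \<in> X. \<exists>z\<in>E. m < cmod (g z)}. OLdist ps \<Omega> f g < e"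
  proof (cases "\<exists>z\<in>E. m < cmod (f z)")
    case True
    then show ?thesis using f \<open>e > 0\<close> by (intro bexI[of _ f]) auto
  next
    case False
    define g where "g = (\<lambda>(n::nat) z. f z + of_real (inverse (real (Suc n))) * k z)"
    have gX: "g n \<in> X" for n unfolding g_def by (intro OLq_add OLq_cmult f k)
    have "(\<lambda>n. OLdist ps \<Omega> (g n) f) \<longlonglongrightarrow> 0"
    proof (rule OLdist_tendsto_0)
      fix j
      have "Lp_norm (ps j) \<Omega> (\<lambda>z. g n z - f z) = inverse (real (Suc n)) * Lp_norm (ps j) \<Omega> k" for n
      proof -
        have "Lp_norm (ps j) \<Omega> (\<lambda>z. of_real (inverse (real (Suc n))) * k z)
          = cmod (of_real (inverse (real (Suc n)))) * Lp_norm (ps j) \<Omega> k"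
          using ps_gt_1[of j] k OLq_measurable by (intro Lp_norm_cmult) auto
        then show ?thesis by (simp add: g_def norm_inverse del: of_nat_Suc)
      qed
      then show "(\<lambda>n. Lp_norm (ps j) \<Omega> (\<lambda>z. g n z - f z)) \<longlonglongrightarrow> 0"
        using tendsto_mult_left_zero[OF LIMSEQ_inverse_real_of_nat] by simp
    qed
    then have "\<forall>\<^sub>F n in sequentially. OLdist ps \<Omega> (g n) f < e"
      using \<open>e > 0\<close> by (rule order_tendstoD)
    then obtain n where n: "OLdist ps \<Omega> (g n) f < e"
      using eventually_happens'[OF sequentially_bot] by blast
    \<comment> \<open>At such \<open>z\<close> the perturbation exceeds
      \<open>2 * \<bar>m\<bar>\<close>, and subtracting
      \<open>cmod (f z) \<le> \<bar>m\<bar>\<close> leaves more than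
      \<open>\<bar>m\<bar>\<close>.\<close>
    obtain z where z: "z \<in> E" "real (Suc n) * (2 * \<bar>m\<bar> ) < cmod (k z)" using unb by blast
    have "2 * \<bar>m\<bar> < inverse (real (Suc n)) * cmod (k z)"
      using z(2) by (simp add: field_simps)
    also have "\<dots> = cmod (g n z - f z)" by (simp add: g_def norm_mult norm_inverse del: of_nat_Suc)
    also have "\<dots> \<le> cmod (g n z) + cmod (f z)" by (rule norm_triangle_ineq4)
    also have "\<dots> \<le> cmod (g n z) + \<bar>m\<bar>" using False z(1) by force
    finally have "m < cmod (g n z)" by linarith
    then show ?thesis
      using z(1) gX n by (intro bexI[of _ "g n"]) (auto simp: OLdist_commute)
  qed
qed auto

text \<open>Otherwise extendable functions \<open>g k\<close> would converge to \<open>h\<close> in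
  the metric, hence pointwise on \<open>E\<close>, and \<open>Lipschitz_extends_limit\<close> would
  make \<open>h\<close> extendable.\<close>

lemma open_not_Lipschitz_extends:
  assumes r: "r > 0" and E: "E \<subseteq> ball c r \<inter> \<Omega>"
  shows "OL_open q ps \<Omega> {h \<in> X. \<not> Lipschitz_extends c r E m h}"
  unfolding OL_open_def
proof (intro conjI ballI)
  fix h assume h: "h \<in> {h \<in> X. \<not> Lipschitz_extends c r E m h}"
  show "\<exists>e>0. \<forall>g\<in>X. OLdist ps \<Omega> h g < e \<longrightarrow> g \<in> {h \<in> X. \<not> Lipschitz_extends c r E m h}"
  proof (rule ccontr)
    assume "\<not> ?thesis"
    then have "\<forall>k::nat. \<exists>g. g \<in> X \<and> OLdist ps \<Omega> h g < inverse (real (Suc k)) \<and> Lipschitz_extends c r E m g"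
      by (metis (mono_tags, lifting) inverse_positive_iff_positive mem_Collect_eq of_nat_0_less_iff zero_less_Suc)
    then obtain g where g: "\<And>k. g k \<in> X" "\<And>k. OLdist ps \<Omega> h (g k) < inverse (real (Suc k))"
       "\<And>k. Lipschitz_extends c r E m (g k)" by metis
    have "Lipschitz_extends c r E m h"
    proof (rule Lipschitz_extends_limit[OF g(3) r])
      show "E \<subseteq> ball c r" using E by blast
      fix z assume z: "z \<in> E"
      show "(\<lambda>k. g k z) \<longlonglongrightarrow> h z"
      proof (rule LIMSEQ_I)
        fix e :: real assume "e > 0"
        then obtain \<delta> where \<delta>: "\<delta> > 0" "\<forall>f\<in>X. \<forall>g\<in>X. OLdist ps \<Omega> f g < \<delta> \<longrightarrow> cmod (f z - g z) < e"
          using evaluation_continuous[of z e] z E by blast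
        obtain N where N: "inverse (real (Suc N)) < \<delta>" using reals_Archimedean[OF \<delta>(1)] by blast
        have "norm (g k z - h z) < e" if "k \<ge> N" for k
        proof -
          have "inverse (real (Suc k)) \<le> inverse (real (Suc N))"
            using that by (intro le_imp_inverse_le) auto
          then have "OLdist ps \<Omega> h (g k) < \<delta>" using g(2)[of k] N by linarith
          then show ?thesis using \<delta>(2) g(1) h by (auto simp: norm_minus_commute)
        qed
        then show "\<exists>N. \<forall>k\<ge>N. norm (g k z - h z) < e" by blast
      qed
    qed
    then show False using h by blast
  qed
qed auto

end

section \<open>The Baire category argument\<close>

theorem theorem4:
  fixes \<Omega> :: "(complex ^ 'n) set" and q :: ereal and ps :: "nat \<Rightarrow> real"
  assumes "bounded \<Omega>" and "open \<Omega>" and "q > 1"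
    and "admissible_seq q ps"
    and "\<forall>\<zeta>\<in>frontier \<Omega>. \<exists>f\<in>OLq q \<Omega>. filterlim f at_infinity (at \<zeta> within \<Omega>)"
  shows "OL_dense q ps \<Omega> {g\<in>OLq q \<Omega>. totally_unbounded \<Omega> g}
       \<and> OL_Gdelta q ps \<Omega> {g\<in>OLq q \<Omega>. totally_unbounded \<Omega> g}
       \<and> OL_dense q ps \<Omega> {h\<in>OLq q \<Omega>. singular_at_boundary \<Omega> h}
       \<and> OL_Gdelta q ps \<Omega> {h\<in>OLq q \<Omega>. singular_at_boundary \<Omega> h}"
proof -
  interpret OL_space \<Omega> q ps by unfold_locales fact+
  obtain I where I: "boundary_test_family \<Omega> I"
    using boundary_test_family_exists[OF open_dom] by blast
  note ID = boundary_test_familyD[OF I]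
  define T where "T = (\<lambda>((c :: complex ^ 'n, r :: real, E), m :: nat). {g \<in> X. \<exists>z\<in>E. real m < cmod (g z)})"
  define N where "N = (\<lambda>((c, r, E), m :: nat). {h \<in> X. \<not> Lipschitz_extends c r E m h})"
  define J where "J = I \<times> (UNIV :: nat set)"
  have "countable J" using I by (auto simp: J_def boundary_test_family_def)
  define TU where "TU = {g\<in>X. totally_unbounded \<Omega> g}"
  define SB where "SB = {h\<in>X. singular_at_boundary \<Omega> h}"
  have TU_eq: "TU = X \<inter> (\<Inter>i\<in>J. T i)"
    unfolding TU_def totally_unbounded_iff[OF open_dom I] by (fastforce simp: J_def T_def)
  have SB_eq: "SB = X \<inter> (\<Inter>i\<in>J. N i)"
  proof (intro equalityI subsetI)
    fix h assume h: "h \<in> SB"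
    have "h \<in> N ((c, r, E), m)" if "(c, r, E) \<in> I" for c r E m
      using singular_imp_not_Lipschitz_extends[OF open_dom ID(2,3)[OF that]] h
      by (auto simp: N_def SB_def)
    then show "h \<in> X \<inter> (\<Inter>i\<in>J. N i)" using h by (auto simp: J_def SB_def)
  next
    fix h assume h: "h \<in> X \<inter> (\<Inter>i\<in>J. N i)"
    have "\<not> Lipschitz_extends c r E m h" if "(c, r, E) \<in> I" for c r E and m :: nat
    proof -
      have "h \<in> N ((c, r, E), m)" using h that by (auto simp: J_def)
      then show ?thesis by (simp add: N_def)
    qed
    moreover have "h \<in> X" "holo_on \<Omega> h" using h by (auto simp: OLq_iff)
    ultimately show "h \<in> SB"
      using not_singular_imp_Lipschitz_extends[OF open_dom _ _ I] unfolding SB_def by blast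
  qed
  have T_open: "OL_open q ps \<Omega> (T i)" if iJ: "i \<in> J" for i
  proof -
    obtain c r E m where i: "i = ((c, r, E), m)" "(c, r, E) \<in> I" using iJ by (auto simp: J_def)
    show ?thesis unfolding i T_def using open_exceeds ID(4)[OF i(2)] by simp
  qed
  have N_open: "OL_open q ps \<Omega> (N i)" if iJ: "i \<in> J" for i
  proof -
    obtain c r E m where i: "i = ((c, r, E), m)" "(c, r, E) \<in> I" using iJ by (auto simp: J_def)
    show ?thesis unfolding i N_def using open_not_Lipschitz_extends[OF ID(1,4)[OF i(2)]] by simp
  qed
  have T_dense: "OL_dense q ps \<Omega> (T i)" if iJ: "i \<in> J" for i
  proof -
    obtain c r E m where i: "i = ((c, r, E), m)" "(c, r, E) \<in> I" using iJ by (auto simp: J_def)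
    obtain \<zeta> where \<zeta>: "\<zeta> \<in> frontier \<Omega>" "\<zeta> \<in> closure E"
      using component_accumulates_at_frontier[OF open_ball connected_ball open_dom ID(2,3)[OF i(2)]] by metis
    obtain k where k: "k \<in> X" "filterlim k at_infinity (at \<zeta> within \<Omega>)" using assms(5) \<zeta>(1) by blast
    have "\<zeta> \<notin> \<Omega>" using \<zeta>(1) open_dom by (simp add: frontier_def interior_open)
    then show ?thesis
      unfolding i T_def using dense_exceeds[OF \<zeta>(2) _ _ k] ID(4)[OF i(2)] by simp
  qed
  \<comment> \<open>Inserting \<open>X\<close> makes the intersection exactly \<open>TU\<close>,
    also for empty \<open>J\<close>.\<close>
  have "M.mtopology closure_of \<Inter>(insert X (T ` J)) = X"
  proof (rule M.metric_Baire_category[OF mcomplete])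
    show "countable (insert X (T ` J))" using \<open>countable J\<close> by simp
    show "openin M.mtopology S \<and> M.mtopology closure_of S = X" if "S \<in> insert X (T ` J)" for S
      using that T_open T_dense OL_open_whole closure_of_topspace[of M.mtopology]
      unfolding OL_open_iff OL_dense_iff by auto
  qed
  then have TU_dense: "OL_dense q ps \<Omega> TU"
    unfolding OL_dense_iff TU_eq by auto
  \<comment> \<open>An extension bounded by \<open>m\<close> on the ball bounds \<open>h\<close> by
    \<open>m\<close> on \<open>E\<close>, which total unboundedness excludes; density of
    \<open>SB\<close> is then inherited from \<open>TU\<close>.\<close>
  have "TU \<subseteq> SB"
  proof
    fix h assume h: "h \<in> TU"
    have "\<not> Lipschitz_extends c r E m h" if "(c, r, E) \<in> I" for c r E and m :: nat
    proof
      assume "Lipschitz_extends c r E m h"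
      then have "cmod (h z) \<le> m" if "z \<in> E" for z
        using that ID(4)[OF \<open>(c, r, E) \<in> I\<close>] ball_subset_cball[of c r]
        unfolding Lipschitz_extends_def by (metis (no_types) IntD1 subsetD)
      moreover have "h \<in> T ((c, r, E), m)" using h that unfolding TU_eq by (auto simp: J_def)
      ultimately show False by (force simp: T_def)
    qed
    then show "h \<in> SB" using h unfolding SB_eq TU_def by (auto simp: J_def N_def)
  qed
  then have SB_dense: "OL_dense q ps \<Omega> SB"
    using TU_dense unfolding OL_dense_def SB_def by blast
  show ?thesis
    using TU_dense SB_dense OL_GdeltaI[OF \<open>countable J\<close> T_open TU_eq] OL_GdeltaI[OF \<open>countable J\<close> N_open SB_eq]
    unfolding TU_def SB_def by blast
qed

end
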